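(* Let $d\ge1$, let $(A_k)_{k\ge1}$ be measurable subsets of $E^d$, and let the sets $C_{k,l}\subset E^d$ ($1\le l\le d$) and $B_{k,I}\subset E^{\mathrm{Card}(I)}$ ($I\subset\{1,\dots,d\}$, $1\le \mathrm{Card}(I)\le d-1$) be defined from $A_k$ as in the context. Then $$\sum_{k=1}^\infty P\big(\exists\,\mathbf{i}\in I_{2^k}:\ X_{\mathbf{i}}\in A_k\big)<\infty$$ if and only if both of the following conditions are satisfied: (1) for every $l=1,\dots,d-1$ and every $I\subset\{1,\dots,d\}$ with $\mathrm{Card}(I)=l$, $$\sum_{k=1}^\infty P\big(\exists\,\mathbf{j}\in I^{l}_{2^k}:\ X_{\mathbf{j}}\in B_{k,I}\big)<\infty;$$ (2) $\displaystyle\sum_{k=1}^\infty 2^{kd}\mu_d(C_{k,1})<\infty.$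
   Context: $(X_j)_{j\ge1}$ is a sequence of i.i.d. random variables with values in a measurable space $E$ and common law $\mu$; $\mu_m=\mu^{\otimes m}$ is the product measure on $E^m$. For a multiindex $\mathbf{j}=(j_1,\dots,j_l)$, $X_{\mathbf{j}}=(X_{j_1},\dots,X_{j_l})$. $I_n^l=\{(j_1,\dots,j_l):1\le j_1<\dots<j_l\le n\}$ and $I_n=I_n^d$. For $I\subset\{1,\dots,d\}$ write $I'=\{1,\dots,d\}\setminus I$ and $x_I=(x_k)_{k\in I}$. For $A\subset E^d$ and $x_I\in E^I$ the section of $A$ at $x_I$ is $A^{x_I}=\{z\in E^{I'}:\ \exists a\in A,\ a_I=x_I,\ a_{I'}=z\}$. For $\mathrm{Card}(I)=l$, $E^I$ is identified with $E^l$ (and $E^{I'}$ with $E^{d-l}$) by listing the coordinates in increasing order. The sets $C_{k,l}$ and $B_{k,I}$ are defined by induction on $d-l$: $C_{k,d}=A_k$, and for $l=d-1,d-2,\dots,1$, $$B_{k,I}=\{x_I\in E^{l}:\ 2^{k(d-l)}\mu_{d-l}(C_{k,l+1}^{x_I})\ge1\}\quad\text{for each } I\subset\{1,\dots,d\}\text{ with }\mathrm{Card}(I)=l,$$ $$C_{k,l}=\{x\in C_{k,l+1}:\ x_I\notin B_{k,I}\text{ for all } I\subset\{1,\dots,d\}\text{ with }\mathrm{Card}(I)=l\}.$$ *)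

theory Defs
  imports "HOL-Probability.Probability"
begin

text \<open>The law \<open>\<mu>\<close> also carries the measurable space \<open>E\<close>. For a finite index set \<open>I\<close>, a point of
  \<open>E\<^sup>I\<close> is an extensional function on \<open>I\<close>, and the product measure on \<open>E\<^sup>I\<close> is
  \<open>\<Pi>\<^sub>M i\<in>I. \<mu>\<close>; in particular \<open>E\<^sup>l\<close> is \<open>E\<^sup>I\<close> for \<open>I = {1..l}\<close>.\<close>

abbreviation power_measure :: "'e measure \<Rightarrow> nat set \<Rightarrow> (nat \<Rightarrow> 'e) measure" where
  "power_measure \<mu> I \<equiv> \<Pi>\<^sub>M i\<in>I. \<mu>"

definition incr_indices :: "nat \<Rightarrow> nat \<Rightarrow> (nat \<Rightarrow> nat) set" where
  "incr_indices l n = {j \<in> {1..l} \<rightarrow>\<^sub>E {1..n}. strict_mono_on {1..l} j}"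

definition multi :: "(nat \<Rightarrow> 'w \<Rightarrow> 'e) \<Rightarrow> nat \<Rightarrow> (nat \<Rightarrow> nat) \<Rightarrow> 'w \<Rightarrow> (nat \<Rightarrow> 'e)" where
  "multi X l j \<omega> = (\<lambda>i\<in>{1..l}. X (j i) \<omega>)"

text \<open>The identification of \<open>E\<^sup>l\<close> with \<open>E\<^sup>I\<close>, where \<open>l = card I\<close>: the coordinate at the \<open>r\<close>-th
  smallest element of \<open>I\<close> is the \<open>r\<close>-th coordinate of \<open>z\<close>.\<close>

definition relabel :: "nat set \<Rightarrow> (nat \<Rightarrow> 'e) \<Rightarrow> (nat \<Rightarrow> 'e)" where
  "relabel I z = (\<lambda>i\<in>I. z (card {i' \<in> I. i' \<le> i}))"

definition slice :: "'e measure \<Rightarrow> nat \<Rightarrow> (nat \<Rightarrow> 'e) set \<Rightarrow> nat set \<Rightarrow> (nat \<Rightarrow> 'e) \<Rightarrow> (nat \<Rightarrow> 'e) set" where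
  "slice \<mu> d A I x =
     {z \<in> ({1..d} - I) \<rightarrow>\<^sub>E space \<mu>. \<exists>a\<in>A. restrict a I = x \<and> restrict a ({1..d} - I) = z}"

definition heavy :: "'e measure \<Rightarrow> nat \<Rightarrow> nat \<Rightarrow> (nat \<Rightarrow> 'e) set \<Rightarrow> nat set \<Rightarrow> (nat \<Rightarrow> 'e) set" where
  "heavy \<mu> d k C I =
     {x \<in> I \<rightarrow>\<^sub>E space \<mu>.
        2 ^ (k * (d - card I)) * measure (power_measure \<mu> ({1..d} - I)) (slice \<mu> d C I x) \<ge> 1}"

text \<open>\<open>C_set \<mu> d k A l\<close> and \<open>B_set \<mu> d k A I\<close> are the sets \<open>C\<^bsub>k,l\<^esub>\<close> and \<open>B\<^bsub>k,I\<^esub>\<close> obtained from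
  \<open>A = A\<^sub>k\<close>; they are meant for \<open>1 \<le> l \<le> d\<close> and for \<open>I \<subseteq> {1..d}\<close> with \<open>1 \<le> card I < d\<close>.\<close>

function C_set :: "'e measure \<Rightarrow> nat \<Rightarrow> nat \<Rightarrow> (nat \<Rightarrow> 'e) set \<Rightarrow> nat \<Rightarrow> (nat \<Rightarrow> 'e) set" where
  "C_set \<mu> d k A l =
     (if d \<le> l then A
      else {x \<in> C_set \<mu> d k A (l + 1).
              \<forall>I. I \<subseteq> {1..d} \<and> card I = l \<longrightarrow>
                  restrict x I \<notin> heavy \<mu> d k (C_set \<mu> d k A (l + 1)) I})"
  by pat_completeness auto
termination
  by (relation "Wellfounded.measure (\<lambda>(\<mu>, d, k, A, l). d - l)") auto

declare C_set.simps [simp del]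

definition B_set :: "'e measure \<Rightarrow> nat \<Rightarrow> nat \<Rightarrow> (nat \<Rightarrow> 'e) set \<Rightarrow> nat set \<Rightarrow> (nat \<Rightarrow> 'e) set" where
  "B_set \<mu> d k A I = heavy \<mu> d k (C_set \<mu> d k A (card I + 1)) I"

end

theory Submission imports Defs begin

text \<open>Fix \<open>k\<close> and put \<open>n = 2\<^sup>k\<close>. Up to constants that depend on \<open>d\<close> only, the probability that some
  increasing index hits \<open>A = A\<^sub>k\<close> is compared with the same quantities for the sets \<open>B\<^bsub>k,I\<^esub>\<close> and with
  \<open>n\<^sup>d \<mu>\<^sub>d(C\<^bsub>k,1\<^esub>)\<close>.

  For sufficiency of the two conditions a union bound is enough: a point of \<open>A\<close> either lies in \<open>C\<^bsub>k,1\<^esub>\<close> or is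
  removed at some level, and then one of its restrictions lies in some \<open>B\<^bsub>k,I\<^esub>\<close>
  (\<open>coupled_le_sum\<close>).

  For necessity, decouple: give every coordinate \<open>r\<close> its own independent sample of size \<open>n\<close>, and let
  \<open>hit S n D\<close> be the probability that a choice of one sample point per coordinate lands in
  \<open>D \<subseteq> E\<^sup>S\<close>. Three facts carry the argument.

  \<^item> Decoupling costs a constant. Cutting each sample into \<open>c\<close> chunks and placing the chunks of the
    different coordinates one after the other gives \<open>hit_le_coupled\<close>; in the other direction, assigning
    the indices to the coordinates by a uniformly random colouring gives \<open>coupled_le_hit\<close>.

  \<^item> The second moment method (\<open>hit_ge\<close>). Let \<open>m = n\<^sup>|\<^sup>S\<^sup>| \<mu>(D)\<close> be the expected number of hits. If every
    section of \<open>D\<close> at a nonempty proper set \<open>J\<close> of coordinates has at most one expected hit, then each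
    agreement pattern \<open>J\<close> of a pair of choices adds at most \<open>m\<close> to the second moment, so that
    \<open>hit S n D \<ge> m / (m + 2\<^sup>|\<^sup>S\<^sup>|)\<close>.

  \<^item> The sets \<open>C\<^bsub>k,l\<^esub>\<close> are trimmed exactly so that this hypothesis on sections holds for all \<open>J\<close> with
    \<open>l \<le> |J| < d\<close> (\<open>fibre_C_set_le\<close>).

  With \<open>D = C\<^bsub>k,1\<^esub>\<close> the second moment bound controls \<open>n\<^sup>d \<mu>\<^sub>d(C\<^bsub>k,1\<^esub>)\<close>. With \<open>D\<close> the section of \<open>C\<^bsub>k,l+1\<^esub>\<close> at a
  point of \<open>B\<^bsub>k,I\<^esub>\<close>, where \<open>m \<ge> 1\<close> by the definition of \<open>B\<^bsub>k,I\<^esub>\<close>, it shows that once the coordinates in \<open>I\<close>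
  hit \<open>B\<^bsub>k,I\<^esub>\<close>, the remaining independent coordinates complete this to a hit of \<open>C\<^bsub>k,l+1\<^esub> \<subseteq> A\<close> with
  conditional probability at least \<open>1 / (1 + 2\<^sup>d)\<close> (\<open>hit_B_set_le\<close>).\<close>

section \<open>Powers of a probability measure\<close>

locale law = prob_space \<mu> for \<mu> :: "'e measure"
begin

abbreviation pow :: "'i set \<Rightarrow> ('i \<Rightarrow> 'e) measure" where
  "pow I \<equiv> Pi\<^sub>M I (\<lambda>_. \<mu>)"

lemma product_prob_space_law: "product_prob_space (\<lambda>_. \<mu>)"
  by unfold_locales

lemma prob_space_pow: "prob_space (pow I)"
  by (rule prob_space_PiM) unfold_locales

lemma measurable_reindex:
  assumes "g \<in> K \<rightarrow> L"
  shows "(\<lambda>w. \<lambda>i\<in>K. w (g i)) \<in> pow L \<rightarrow>\<^sub>M pow K"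
  using assms by (intro measurable_restrict measurable_component_singleton) auto

text \<open>Sampling distinct coordinates of an i.i.d. family gives again an i.i.d. family. All comparisons
  between differently indexed samples below rest on this, applied to a suitable injection \<open>g\<close>.\<close>

lemma measure_reindex:
  assumes "inj_on g K" "g \<in> K \<rightarrow> L" "Q \<in> sets (pow K)"
  shows "measure (pow L) {w \<in> space (pow L). (\<lambda>i\<in>K. w (g i)) \<in> Q} = measure (pow K) Q"
proof -
  have "pow K = distr (pow L) (pow K) (\<lambda>w. \<lambda>i\<in>K. w (g i))"
    using distr_PiM_reindex[of L "\<lambda>_. \<mu>" g K] assms(1,2) prob_space_axioms by simp
  then have "measure (pow K) Q = measure (distr (pow L) (pow K) (\<lambda>w. \<lambda>i\<in>K. w (g i))) Q"
    by simp
  also have "\<dots> = measure (pow L) ((\<lambda>w. \<lambda>i\<in>K. w (g i)) -` Q \<inter> space (pow L))"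
    by (rule measure_distr[OF measurable_reindex[OF assms(2)] assms(3)])
  also have "(\<lambda>w. \<lambda>i\<in>K. w (g i)) -` Q \<inter> space (pow L)
      = {w \<in> space (pow L). (\<lambda>i\<in>K. w (g i)) \<in> Q}"
    by blast
  finally show ?thesis by simp
qed

lemma sets_sample:
  assumes "finite T" "\<And>t r. t \<in> T \<Longrightarrow> r \<in> S \<Longrightarrow> h t r \<in> L" "D \<in> sets (pow S)"
  shows "{w \<in> space (pow L). \<exists>t\<in>T. (\<lambda>r\<in>S. w (h t r)) \<in> D} \<in> sets (pow L)"
proof -
  have "{w \<in> space (pow L). \<exists>t\<in>T. (\<lambda>r\<in>S. w (h t r)) \<in> D}
      = (\<Union>t\<in>T. (\<lambda>w. \<lambda>r\<in>S. w (h t r)) -` D \<inter> space (pow L))"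
    by blast
  also have "\<dots> \<in> sets (pow L)"
    using assms by (intro sets.finite_UN measurable_sets[OF measurable_reindex]) auto
  finally show ?thesis .
qed

text \<open>This agrees with \<open>slice\<close> on \<open>{1..d}\<close> (lemma \<open>slice_eq_fibre\<close>), but is available for every pair of
  index sets, in particular for index sets of samples, which consist of pairs.\<close>

definition fibre :: "'i set \<Rightarrow> 'i set \<Rightarrow> ('i \<Rightarrow> 'e) set \<Rightarrow> ('i \<Rightarrow> 'e) \<Rightarrow> ('i \<Rightarrow> 'e) set" where
  "fibre U V A x = {y \<in> space (pow V). merge U V (x, y) \<in> A}"

lemma fibre_sets:
  assumes "A \<in> sets (pow (U \<union> V))" "x \<in> space (pow U)"
  shows "fibre U V A x \<in> sets (pow V)"
proof -
  have "(\<lambda>y. merge U V (x, y)) \<in> pow V \<rightarrow>\<^sub>M pow (U \<union> V)"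
    using assms(2) by measurable
  moreover have "fibre U V A x = (\<lambda>y. merge U V (x, y)) -` A \<inter> space (pow V)"
    unfolding fibre_def by blast
  ultimately show ?thesis using assms(1) by (metis measurable_sets)
qed

lemma emeasure_fibre:
  assumes "U \<inter> V = {}" "finite U" "finite V" "A \<in> sets (pow (U \<union> V))"
  shows "emeasure (pow (U \<union> V)) A
      = (\<integral>\<^sup>+x. ennreal (measure (pow V) (fibre U V A x)) \<partial>pow U)"
proof -
  interpret product_prob_space "\<lambda>_. \<mu>" by (rule product_prob_space_law)
  interpret V: prob_space "pow V" by (rule prob_space_pow)
  have "(\<lambda>y. merge U V (x, y)) -` A \<inter> space (pow V) = fibre U V A x" for x
    unfolding fibre_def by blast
  then show ?thesis
    unfolding emeasure_fold_integral[OF assms] by (simp add: V.emeasure_eq_measure)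
qed

lemma measurable_measure_fibre:
  assumes "U \<inter> V = {}" "finite U" "finite V" "A \<in> sets (pow (U \<union> V))"
  shows "(\<lambda>x. measure (pow V) (fibre U V A x)) \<in> borel_measurable (pow U)"
proof -
  interpret product_prob_space "\<lambda>_. \<mu>" by (rule product_prob_space_law)
  have "(\<lambda>y. merge U V (x, y)) -` A \<inter> space (pow V) = fibre U V A x" for x
    unfolding fibre_def by blast
  then show ?thesis
    using emeasure_fold_measurable[OF assms] unfolding measure_def by simp
qed

lemma measure_le_of_fibre_le:
  assumes "U \<inter> V = {}" "finite U" "finite V" "A \<in> sets (pow (U \<union> V))" "D \<in> sets (pow U)"
    and "b \<ge> 0"
    and le: "\<And>x. x \<in> space (pow U) \<Longrightarrow> measure (pow V) (fibre U V A x) \<le> b * indicator D x"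
  shows "measure (pow (U \<union> V)) A \<le> b * measure (pow U) D"
proof -
  interpret U: prob_space "pow U" by (rule prob_space_pow)
  interpret UV: prob_space "pow (U \<union> V)" by (rule prob_space_pow)
  have "emeasure (pow (U \<union> V)) A
      = (\<integral>\<^sup>+x. ennreal (measure (pow V) (fibre U V A x)) \<partial>pow U)"
    by (rule emeasure_fibre[OF assms(1-4)])
  also have "\<dots> \<le> (\<integral>\<^sup>+x. ennreal b * indicator D x \<partial>pow U)"
  proof (rule nn_integral_mono)
    fix x assume "x \<in> space (pow U)"
    from le[OF this] show "ennreal (measure (pow V) (fibre U V A x)) \<le> ennreal b * indicator D x"
      by (cases "x \<in> D") (auto intro: ennreal_leI simp: measure_le_0_iff)
  qed
  also have "\<dots> = ennreal b * emeasure (pow U) D"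
    using assms(5) by (rule nn_integral_cmult_indicator)
  finally show ?thesis
    using \<open>b \<ge> 0\<close> by (simp add: U.emeasure_eq_measure UV.emeasure_eq_measure flip: ennreal_mult)
qed

lemma measure_ge_of_fibre_ge:
  assumes "U \<inter> V = {}" "finite U" "finite V" "A \<in> sets (pow (U \<union> V))" "D \<in> sets (pow U)"
    and "b \<ge> 0"
    and ge: "\<And>x. x \<in> D \<Longrightarrow> b \<le> measure (pow V) (fibre U V A x)"
  shows "b * measure (pow U) D \<le> measure (pow (U \<union> V)) A"
proof -
  interpret U: prob_space "pow U" by (rule prob_space_pow)
  interpret UV: prob_space "pow (U \<union> V)" by (rule prob_space_pow)
  have "ennreal b * emeasure (pow U) D = (\<integral>\<^sup>+x. ennreal b * indicator D x \<partial>pow U)"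
    using assms(5) by (rule nn_integral_cmult_indicator[symmetric])
  also have "\<dots> \<le> (\<integral>\<^sup>+x. ennreal (measure (pow V) (fibre U V A x)) \<partial>pow U)"
  proof (rule nn_integral_mono)
    fix x
    show "ennreal b * indicator D x \<le> ennreal (measure (pow V) (fibre U V A x))"
      using ge[of x] by (cases "x \<in> D") (auto intro: ennreal_leI)
  qed
  also have "\<dots> = emeasure (pow (U \<union> V)) A"
    by (rule emeasure_fibre[OF assms(1-4), symmetric])
  finally show ?thesis
    using \<open>b \<ge> 0\<close> by (simp add: U.emeasure_eq_measure UV.emeasure_eq_measure flip: ennreal_mult)
qed

end

section \<open>Decoupled hitting probabilities\<close>

text \<open>With \<open>Z\<close> the number of events that occur, this is the bound
  \<open>P(Z > 0) \<ge> (\<E> Z)\<^sup>2 / \<E> (Z\<^sup>2)\<close> with \<open>\<E> Z = m\<close> and \<open>\<E> (Z\<^sup>2) \<le> m (m + K)\<close>.\<close>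

lemma (in prob_space) second_moment_union:
  fixes m K :: real
  assumes "finite T" "\<And>t. t \<in> T \<Longrightarrow> E t \<in> events" "m \<ge> 0" "K > 0"
    and first: "(\<Sum>t\<in>T. prob (E t)) = m"
    and second: "(\<Sum>t\<in>T. \<Sum>t'\<in>T. prob (E t \<inter> E t')) \<le> m * (m + K)"
  shows "m / (m + K) \<le> prob (\<Union>t\<in>T. E t)"
proof -
  define Z where "Z w = (\<Sum>t\<in>T. indicator (E t) w :: real)" for w
  define a where "a = 1 / (m + K)"
  have ev: "E t \<inter> E t' \<in> events" if "t \<in> T" "t' \<in> T" for t t'
    using assms(2) that by blast
  have int1: "integrable M (indicator B :: _ \<Rightarrow> real)" if "B \<in> events" for B
    using that by (simp add: integrable_indicator_iff emeasure_eq_measure)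
  have Z2: "Z w * Z w = (\<Sum>t\<in>T. \<Sum>t'\<in>T. indicator (E t \<inter> E t') w)" for w
    unfolding Z_def by (simp add: sum_product indicator_inter_arith)
  have iZ: "integrable M Z"
    unfolding Z_def using assms(2) by (intro Bochner_Integration.integrable_sum int1)
  have iZ2: "integrable M (\<lambda>w. Z w * Z w)"
    unfolding Z2 using ev by (intro Bochner_Integration.integrable_sum int1)
  have eZ: "expectation Z = m"
    unfolding Z_def using assms(2) int1 first by (simp add: Bochner_Integration.integral_sum)
  have eZ2: "expectation (\<lambda>w. Z w * Z w) = (\<Sum>t\<in>T. \<Sum>t'\<in>T. prob (E t \<inter> E t'))"
  proof -
    have "expectation (\<lambda>w. Z w * Z w)
        = (\<Sum>t\<in>T. expectation (\<lambda>w. \<Sum>t'\<in>T. indicator (E t \<inter> E t') w))"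
      unfolding Z2 using ev
      by (intro Bochner_Integration.integral_sum Bochner_Integration.integrable_sum int1)
    also have "\<dots> = (\<Sum>t\<in>T. \<Sum>t'\<in>T. expectation (indicator (E t \<inter> E t')))"
      using ev by (intro sum.cong refl Bochner_Integration.integral_sum int1)
    also have "\<dots> = (\<Sum>t\<in>T. \<Sum>t'\<in>T. prob (E t \<inter> E t'))"
      using ev by (intro sum.cong refl) simp
    finally show ?thesis .
  qed
  have U: "(\<Union>t\<in>T. E t) \<in> events"
    using assms(1,2) by blast
  \<comment> \<open>A quadratic minorant of the indicator of \<open>Z > 0\<close>; this \<open>a\<close> maximises its expectation.\<close>
  have pt: "2 * a * Z w - a\<^sup>2 * (Z w * Z w) \<le> indicator (\<Union>t\<in>T. E t) w" for w
  proof (cases "w \<in> (\<Union>t\<in>T. E t)")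
    case True
    have "0 \<le> (1 - a * Z w)\<^sup>2" by simp
    then show ?thesis using True by (simp add: power2_eq_square algebra_simps)
  next
    case False
    then have "Z w = 0" unfolding Z_def by (intro sum.neutral) auto
    then show ?thesis using False by simp
  qed
  have "expectation (\<lambda>w. 2 * a * Z w - a\<^sup>2 * (Z w * Z w))
      \<le> expectation (indicator (\<Union>t\<in>T. E t))"
    by (intro integral_mono Bochner_Integration.integrable_diff
        Bochner_Integration.integrable_mult_right int1 U iZ iZ2 pt)
  moreover have "expectation (\<lambda>w. 2 * a * Z w - a\<^sup>2 * (Z w * Z w))
      = 2 * a * m - a\<^sup>2 * (\<Sum>t\<in>T. \<Sum>t'\<in>T. prob (E t \<inter> E t'))"
    using iZ iZ2 eZ eZ2 by (simp add: Bochner_Integration.integral_diff)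
  moreover have "a\<^sup>2 * (\<Sum>t\<in>T. \<Sum>t'\<in>T. prob (E t \<inter> E t')) \<le> a\<^sup>2 * (m * (m + K))"
    using second by (rule mult_left_mono) simp
  moreover have "2 * a * m - a\<^sup>2 * (m * (m + K)) = m / (m + K)"
  proof -
    have "a * (m + K) = 1" using assms(3,4) unfolding a_def by simp
    then have "a\<^sup>2 * (m * (m + K)) = a * m"
      by (simp add: power2_eq_square mult.assoc mult.left_commute)
    then show ?thesis unfolding a_def by simp
  qed
  ultimately show ?thesis using U by simp
qed

context law
begin

text \<open>Coordinate \<open>(r, s)\<close> of the sample is the \<open>s\<close>-th draw of the private sample of coordinate \<open>r\<close>.\<close>

definition hit :: "'i set \<Rightarrow> nat \<Rightarrow> ('i \<Rightarrow> 'e) set \<Rightarrow> real" where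
  "hit S n D = measure (pow (S \<times> {1..n}))
     {w \<in> space (pow (S \<times> {1..n})). \<exists>t\<in>S \<rightarrow>\<^sub>E {1..n}. (\<lambda>r\<in>S. w (r, t r)) \<in> D}"

text \<open>Given that the choice \<open>t\<close> hits \<open>D\<close>, the choice \<open>t'\<close> shares the coordinates in \<open>J\<close> and is
  independent of \<open>t\<close> elsewhere, so that it hits with conditional probability the measure of a section of \<open>D\<close>
  at \<open>J\<close>. For \<open>J = {}\<close> this is the measure of \<open>D\<close>; for \<open>J = S\<close> the bound is \<open>1\<close>.\<close>

lemma pair_hit_le:
  fixes n :: nat
  assumes "finite S" "D \<in> sets (pow S)" "n \<ge> 1"
    and t: "t \<in> S \<rightarrow>\<^sub>E {1..n}" and t': "t' \<in> S \<rightarrow>\<^sub>E {1..n}"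
    and J: "J = {r \<in> S. t r = t' r}"
    and sec: "\<And>x. J \<noteq> {} \<Longrightarrow> J \<noteq> S \<Longrightarrow> x \<in> space (pow J) \<Longrightarrow>
        real n ^ card (S - J) * measure (pow (S - J)) (fibre J (S - J) D x) \<le> 1"
  shows "measure (pow (S \<times> {1..n})) {w \<in> space (pow (S \<times> {1..n})).
           (\<lambda>r\<in>S. w (r, t r)) \<in> D \<and> (\<lambda>r\<in>S. w (r, t' r)) \<in> D}
         \<le> (if J = {} then measure (pow S) D else 1 / real n ^ card (S - J)) * measure (pow S) D"
    (is "measure _ ?A \<le> ?b * _")
proof -
  define L where "L = S \<times> {1..n}"
  define U where "U = (\<lambda>r. (r, t r)) ` S"
  define V where "V = L - U"
  have UL: "U \<subseteq> L" unfolding U_def L_def using t by auto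
  \<comment> \<open>Condition on the draws used by \<open>t\<close>, which are those indexed by \<open>U\<close>.\<close>
  have L: "U \<union> V = L" and disj: "U \<inter> V = {}" and fin: "finite U" "finite V"
    using UL assms(1) unfolding V_def L_def U_def by auto
  have JS: "J \<subseteq> S" using J by auto
  interpret PS: prob_space "pow (S - J)" by (rule prob_space_pow)
  interpret PV: prob_space "pow V" by (rule prob_space_pow)
  define DU where "DU = {x \<in> space (pow U). (\<lambda>r\<in>S. x (r, t r)) \<in> D}"
  have gU: "(\<lambda>r. (r, t r)) \<in> S \<rightarrow> U" "inj_on (\<lambda>r. (r, t r)) S"
    unfolding U_def by (auto simp: inj_on_def)
  have DUs: "DU \<in> sets (pow U)"
  proof -
    have "{x \<in> space (pow U). \<exists>s\<in>{t}. (\<lambda>r\<in>S. x (r, s r)) \<in> D} \<in> sets (pow U)"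
      using gU(1) assms(2) by (intro sets_sample) auto
    then show ?thesis unfolding DU_def by simp
  qed
  have mDU: "measure (pow U) DU = measure (pow S) D"
    unfolding DU_def using gU assms(2) by (intro measure_reindex)
  have As: "?A \<in> sets (pow L)"
  proof -
    have "?A = {w \<in> space (pow L). \<exists>s\<in>{t}. (\<lambda>r\<in>S. w (r, s r)) \<in> D} \<inter>
       {w \<in> space (pow L). \<exists>s\<in>{t'}. (\<lambda>r\<in>S. w (r, s r)) \<in> D}"
      unfolding L_def by auto
    moreover have "\<dots> \<in> sets (pow L)"
      using t t' assms(2) unfolding L_def by (intro sets.Int sets_sample) auto
    ultimately show ?thesis by simp
  qed
  have gV: "(\<lambda>r. (r, t' r)) \<in> (S - J) \<rightarrow> V" "inj_on (\<lambda>r. (r, t' r)) (S - J)"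
    using t' unfolding V_def U_def L_def J by (auto simp: inj_on_def)
  have "measure (pow (U \<union> V)) ?A \<le> ?b * measure (pow U) DU"
  proof (rule measure_le_of_fibre_le[OF disj fin _ DUs])
    show "?A \<in> sets (pow (U \<union> V))" using As L by simp
    show "0 \<le> ?b" by simp
    fix x assume x: "x \<in> space (pow U)"
    show "measure (pow V) (fibre U V ?A x) \<le> ?b * indicator DU x"
    proof (cases "x \<in> DU")
      case False
      have "fibre U V ?A x = {}"
      proof -
        have "(\<lambda>r\<in>S. merge U V (x, y) (r, t r)) = (\<lambda>r\<in>S. x (r, t r))" for y
          by (auto simp: merge_def U_def fun_eq_iff)
        then show ?thesis using False x unfolding fibre_def DU_def by auto
      qed
      then show ?thesis using False by simp
    next
      case True
      define x' where "x' = (\<lambda>r\<in>J. x (r, t r))"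
      have x': "x' \<in> space (pow J)"
        using x JS unfolding x'_def U_def by (auto simp: space_PiM PiE_def Pi_def)
      define F where "F = fibre J (S - J) D x'"
      have Fs: "F \<in> sets (pow (S - J))"
        unfolding F_def using assms(2) JS x' by (intro fibre_sets) (auto simp: Un_absorb1)
      have sub: "fibre U V ?A x \<subseteq> {y \<in> space (pow V). (\<lambda>r\<in>S - J. y (r, t' r)) \<in> F}"
      proof
        fix y assume y: "y \<in> fibre U V ?A x"
        then have yV: "y \<in> space (pow V)"
          and yD: "(\<lambda>r\<in>S. merge U V (x, y) (r, t' r)) \<in> D"
          unfolding fibre_def by auto
        have "merge U V (x, y) (r, t' r)
            = merge J (S - J) (x', \<lambda>r\<in>S - J. y (r, t' r)) r" if "r \<in> S" for r
        proof (cases "r \<in> J")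
          case True
          then have "(r, t' r) \<in> U" "t' r = t r" unfolding J U_def by auto
          then show ?thesis using True by (simp add: merge_def x'_def)
        next
          case False
          then have "(r, t' r) \<notin> U" "(r, t' r) \<in> V"
            using that gV(1) unfolding V_def by auto
          then show ?thesis using False that by (simp add: merge_def)
        qed
        then have "(\<lambda>r\<in>S. merge U V (x, y) (r, t' r))
            = merge J (S - J) (x', \<lambda>r\<in>S - J. y (r, t' r))"
          using JS by (auto simp: fun_eq_iff merge_def)
        moreover have "(\<lambda>r\<in>S - J. y (r, t' r)) \<in> space (pow (S - J))"
          using yV gV(1) by (auto simp: space_PiM PiE_def Pi_def)
        ultimately show "y \<in> {y \<in> space (pow V). (\<lambda>r\<in>S - J. y (r, t' r)) \<in> F}"
          using yV yD unfolding F_def fibre_def by simp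
      qed
      have "measure (pow V) (fibre U V ?A x)
          \<le> measure (pow V) {y \<in> space (pow V). (\<lambda>r\<in>S - J. y (r, t' r)) \<in> F}"
      proof (rule PV.finite_measure_mono[OF sub])
        show "{y \<in> space (pow V). (\<lambda>r\<in>S - J. y (r, t' r)) \<in> F} \<in> sets (pow V)"
        proof -
          have "{y \<in> space (pow V). \<exists>s\<in>{t'}. (\<lambda>r\<in>S - J. y (r, s r)) \<in> F} \<in> sets (pow V)"
            using gV(1) Fs by (intro sets_sample) auto
          then show ?thesis by simp
        qed
      qed
      also have "\<dots> = measure (pow (S - J)) F"
        using gV Fs by (intro measure_reindex)
      also have "\<dots> \<le> ?b"
      proof (cases "J = {}")
        case True
        have "D \<subseteq> space (pow S)" using assms(2) by (rule sets.sets_into_space)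
        moreover have "merge {} S (x', y) = y" if "y \<in> space (pow S)" for y
          using that by (auto simp: space_PiM merge_def PiE_def extensional_def fun_eq_iff)
        ultimately have "F = D" using True unfolding F_def fibre_def by auto
        then show ?thesis using True by simp
      next
        case False
        show ?thesis
        proof (cases "J = S")
          case True
          then show ?thesis using False PS.prob_le_1[of F] by simp
        next
          case False
          have "real n ^ card (S - J) * measure (pow (S - J)) F \<le> 1"
            unfolding F_def using \<open>J \<noteq> {}\<close> False x' by (rule sec)
          then show ?thesis using \<open>J \<noteq> {}\<close> \<open>n \<ge> 1\<close> by (simp add: field_simps)
        qed
      qed
      finally show ?thesis using True by simp
    qed
  qed
  then show ?thesis unfolding mDU L unfolding L_def by simp
qed

text \<open>There are at most \<open>n\<^sup>|\<^sup>S\<^sup>-\<^sup>J\<^sup>|\<close> choices \<open>t'\<close> that agree with a given \<open>t\<close> exactly on \<open>J\<close>; this factor cancels the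
  bound on the section at \<open>J\<close>, so each of the at most \<open>2\<^sup>|\<^sup>S\<^sup>|\<close> patterns \<open>J \<noteq> {}\<close> contributes at most \<open>m\<close> to
  the second moment, while the pattern \<open>{}\<close> contributes at most \<open>m\<^sup>2\<close>.\<close>

lemma hit_ge:
  fixes n :: nat
  assumes "finite S" "S \<noteq> {}" "D \<in> sets (pow S)" "n \<ge> 1"
    and sec: "\<And>J x. J \<subseteq> S \<Longrightarrow> J \<noteq> {} \<Longrightarrow> J \<noteq> S \<Longrightarrow> x \<in> space (pow J) \<Longrightarrow>
        real n ^ card (S - J) * measure (pow (S - J)) (fibre J (S - J) D x) \<le> 1"
    and m: "m = real n ^ card S * measure (pow S) D"
  shows "m / (m + 2 ^ card S) \<le> hit S n D"
proof -
  define L where "L = S \<times> {1..n}"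
  define T where "T = S \<rightarrow>\<^sub>E {1..n}"
  define E where "E t = {w \<in> space (pow L). (\<lambda>r\<in>S. w (r, t r)) \<in> D}" for t
  define p where "p = measure (pow S) D"
  define b where "b J = (if J = {} then p else 1 / real n ^ card (S - J))" for J
  interpret P: prob_space "pow L" by (rule prob_space_pow)
  have p0: "p \<ge> 0" unfolding p_def by simp
  have finT: "finite T" unfolding T_def using assms(1) by (intro finite_PiE) auto
  have cardT: "card T = n ^ card S"
    unfolding T_def using assms(1) by (simp add: card_PiE)
  have Es: "E t \<in> P.events" if "t \<in> T" for t
    using sets_sample[of "{t}" S "\<lambda>t r. (r, t r)" L D] that assms(3)
    unfolding E_def T_def L_def by (auto simp: PiE_def Pi_def)
  have PE: "P.prob (E t) = p" if "t \<in> T" for t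
    unfolding E_def p_def using that assms(3) unfolding T_def L_def
    by (intro measure_reindex) (auto simp: inj_on_def)
  have PEE: "P.prob (E t \<inter> E t') \<le> b {r \<in> S. t r = t' r} * p" if "t \<in> T" "t' \<in> T" for t t'
  proof -
    have "E t \<inter> E t' = {w \<in> space (pow (S \<times> {1..n})).
           (\<lambda>r\<in>S. w (r, t r)) \<in> D \<and> (\<lambda>r\<in>S. w (r, t' r)) \<in> D}"
      unfolding E_def L_def by auto
    then show ?thesis
      using pair_hit_le[OF assms(1,3,4) that[unfolded T_def] refl sec]
      unfolding b_def p_def L_def by simp
  qed
  have row: "(\<Sum>t'\<in>T. P.prob (E t \<inter> E t')) \<le> (m + 2 ^ card S) * p" if t: "t \<in> T" for t
  proof -
    define a where "a t' = {r \<in> S. t r = t' r}" for t'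
    have cnt: "card {t' \<in> T. a t' = J} \<le> n ^ card (S - J)" if J: "J \<subseteq> S" for J
    proof -
      let ?Q = "PiE S (\<lambda>r. if r \<in> J then {t r} else {1..n})"
      have "{t' \<in> T. a t' = J} \<subseteq> ?Q"
        unfolding T_def a_def by (auto simp: PiE_def Pi_def)
      moreover have "finite ?Q" using assms(1) by (intro finite_PiE) auto
      ultimately have "card {t' \<in> T. a t' = J} \<le> card ?Q" by (rule card_mono[rotated])
      also have "\<dots> = (\<Prod>r\<in>S. if r \<in> J then 1 else n)"
        using assms(1) by (simp add: card_PiE if_distrib[of card] cong: if_cong)
      also have "\<dots> = (\<Prod>r\<in>S - J. n)"
        using assms(1) J by (intro prod.mono_neutral_cong_right) auto
      finally show ?thesis by simp
    qed
    have bb: "real (card {t' \<in> T. a t' = J}) * (b J * p) \<le> (if J = {} then m * p else p)"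
      if J: "J \<subseteq> S" for J
    proof (cases "J = {}")
      case True
      have "real (card {t' \<in> T. a t' = J}) \<le> real n ^ card S"
        using cnt[OF J] True by (metis Diff_empty of_nat_le_iff of_nat_power)
      then have "real (card {t' \<in> T. a t' = J}) * (p * p) \<le> real n ^ card S * (p * p)"
        by (rule mult_right_mono) (simp add: p0)
      then show ?thesis using True unfolding b_def m p_def by (simp add: mult.assoc)
    next
      case False
      have "real (card {t' \<in> T. a t' = J}) \<le> real n ^ card (S - J)"
        using cnt[OF J] by (metis of_nat_le_iff of_nat_power)
      then have "real (card {t' \<in> T. a t' = J}) * (b J * p) \<le> real n ^ card (S - J) * (b J * p)"
        by (rule mult_right_mono) (simp add: p0 b_def)
      then show ?thesis using False \<open>n \<ge> 1\<close> unfolding b_def by simp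
    qed
    have "(\<Sum>t'\<in>T. P.prob (E t \<inter> E t')) \<le> (\<Sum>t'\<in>T. b (a t') * p)"
      unfolding a_def by (intro sum_mono PEE t)
    also have "\<dots> = (\<Sum>J\<in>Pow S. \<Sum>t'\<in>{t' \<in> T. a t' = J}. b (a t') * p)"
      using finT assms(1) by (intro sum.group[symmetric]) (auto simp: a_def)
    also have "\<dots> = (\<Sum>J\<in>Pow S. real (card {t' \<in> T. a t' = J}) * (b J * p))"
      by (intro sum.cong refl) simp
    also have "\<dots> \<le> (\<Sum>J\<in>Pow S. if J = {} then m * p else p)"
      by (intro sum_mono bb) auto
    also have "\<dots> \<le> (\<Sum>J\<in>Pow S. (if J = {} then m * p else 0) + p)"
      by (intro sum_mono) (auto simp: p0)
    also have "\<dots> = m * p + 2 ^ card S * p"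
      using assms(1) by (simp add: sum.distrib sum.delta' card_Pow)
    finally show ?thesis by (simp add: algebra_simps)
  qed
  have "m / (m + 2 ^ card S) \<le> P.prob (\<Union>t\<in>T. E t)"
  proof (rule P.second_moment_union[OF finT Es])
    show "0 \<le> m" unfolding m by simp
    show "(\<Sum>t\<in>T. P.prob (E t)) = m"
      using PE cardT by (simp add: m p_def)
    have "(\<Sum>t\<in>T. \<Sum>t'\<in>T. P.prob (E t \<inter> E t')) \<le> (\<Sum>t\<in>T. (m + 2 ^ card S) * p)"
      by (intro sum_mono row)
    also have "\<dots> = m * (m + 2 ^ card S)"
      by (simp add: cardT m p_def)
    finally show "(\<Sum>t\<in>T. \<Sum>t'\<in>T. P.prob (E t \<inter> E t')) \<le> m * (m + 2 ^ card S)" .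
  qed auto
  moreover have "(\<Union>t\<in>T. E t) = {w \<in> space (pow (S \<times> {1..n})). \<exists>t\<in>S \<rightarrow>\<^sub>E {1..n}. (\<lambda>r\<in>S. w (r, t r)) \<in> D}"
    unfolding E_def T_def L_def by blast
  ultimately show ?thesis unfolding hit_def L_def by simp
qed

lemma hit_sets:
  fixes n :: nat
  assumes "finite S" "D \<in> sets (pow S)"
  shows "{w \<in> space (pow (S \<times> {1..n})). \<exists>t\<in>S \<rightarrow>\<^sub>E {1..n}. (\<lambda>r\<in>S. w (r, t r)) \<in> D}
     \<in> sets (pow (S \<times> {1..n}))"
  using assms by (intro sets_sample finite_PiE) auto

lemma hit_mono:
  assumes "finite S" "C \<subseteq> D" "D \<in> sets (pow S)"
  shows "hit S n C \<le> hit S n D"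
proof -
  interpret P: prob_space "pow (S \<times> {1..n})" by (rule prob_space_pow)
  show ?thesis
    unfolding hit_def using assms
    by (intro P.finite_measure_mono hit_sets) auto
qed

text \<open>Condition on the samples of the coordinates in \<open>U\<close>. When they hit \<open>B\<close>, say at \<open>x\<close>, it suffices that
  the independent samples of the coordinates in \<open>V\<close> hit the section of \<open>C\<close> at \<open>x\<close>.\<close>

lemma hit_fibre_ge:
  assumes "U \<inter> V = {}" "finite U" "finite V"
    and C: "C \<in> sets (pow (U \<union> V))" and B: "B \<in> sets (pow U)" and "b \<ge> 0"
    and ge: "\<And>x. x \<in> B \<Longrightarrow> b \<le> hit V n (fibre U V C x)"
  shows "b * hit U n B \<le> hit (U \<union> V) n C"
proof -
  define LU where "LU = U \<times> {1..n}"
  define LV where "LV = V \<times> {1..n}"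
  have L: "(U \<union> V) \<times> {1..n} = LU \<union> LV" unfolding LU_def LV_def by auto
  define HC where "HC = {w \<in> space (pow (LU \<union> LV)).
     \<exists>t\<in>(U \<union> V) \<rightarrow>\<^sub>E {1..n}. (\<lambda>r\<in>U \<union> V. w (r, t r)) \<in> C}"
  define HB where "HB = {w \<in> space (pow LU). \<exists>t\<in>U \<rightarrow>\<^sub>E {1..n}. (\<lambda>r\<in>U. w (r, t r)) \<in> B}"
  interpret PV: prob_space "pow LV" by (rule prob_space_pow)
  have HCs: "HC \<in> sets (pow (LU \<union> LV))"
    using hit_sets[of "U \<union> V" C n] assms(2,3) C unfolding HC_def L by simp
  have HBs: "HB \<in> sets (pow LU)"
    using hit_sets[of U B n] assms(2) B unfolding HB_def LU_def by simp
  have "b * measure (pow LU) HB \<le> measure (pow (LU \<union> LV)) HC"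
  proof (rule measure_ge_of_fibre_ge[OF _ _ _ HCs HBs \<open>b \<ge> 0\<close>])
    show "LU \<inter> LV = {}" "finite LU" "finite LV"
      using assms(1-3) unfolding LU_def LV_def by auto
    fix w assume w: "w \<in> HB"
    then obtain t where t: "t \<in> U \<rightarrow>\<^sub>E {1..n}" and tB: "(\<lambda>r\<in>U. w (r, t r)) \<in> B"
      and wS: "w \<in> space (pow LU)" unfolding HB_def by blast
    define x where "x = (\<lambda>r\<in>U. w (r, t r))"
    have "b \<le> hit V n (fibre U V C x)"
      using tB unfolding x_def by (rule ge)
    also have "\<dots> \<le> measure (pow LV) (fibre LU LV HC w)"
      unfolding hit_def LV_def[symmetric]
    proof (rule PV.finite_measure_mono)
      show "fibre LU LV HC w \<in> PV.events"
        using HCs wS by (rule fibre_sets)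
      show "{y \<in> space (pow LV). \<exists>s\<in>V \<rightarrow>\<^sub>E {1..n}. (\<lambda>r\<in>V. y (r, s r)) \<in> fibre U V C x}
          \<subseteq> fibre LU LV HC w"
      proof
        fix y assume "y \<in> {y \<in> space (pow LV).
            \<exists>s\<in>V \<rightarrow>\<^sub>E {1..n}. (\<lambda>r\<in>V. y (r, s r)) \<in> fibre U V C x}"
        then obtain s where y: "y \<in> space (pow LV)" and s: "s \<in> V \<rightarrow>\<^sub>E {1..n}"
          and sC: "merge U V (x, \<lambda>r\<in>V. y (r, s r)) \<in> C"
          unfolding fibre_def by blast
        have mS: "merge LU LV (w, y) \<in> space (pow (LU \<union> LV))"
          using wS y by (auto simp: space_PiM PiE_def Pi_def merge_def extensional_def)
        define u where "u = merge U V (t, s)"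
        have u: "u \<in> (U \<union> V) \<rightarrow>\<^sub>E {1..n}"
          using t s assms(1) unfolding u_def merge_def PiE_def Pi_def extensional_def by auto
        have "merge LU LV (w, y) (r, u r) = merge U V (x, \<lambda>r\<in>V. y (r, s r)) r"
          if "r \<in> U \<union> V" for r
          using that t s assms(1) unfolding u_def x_def LU_def LV_def
          by (auto simp: merge_def PiE_def Pi_def)
        then have "(\<lambda>r\<in>U \<union> V. merge LU LV (w, y) (r, u r)) = merge U V (x, \<lambda>r\<in>V. y (r, s r))"
          by (auto simp: fun_eq_iff merge_def)
        then have "merge LU LV (w, y) \<in> HC"
          unfolding HC_def using mS u sC by (simp only: mem_Collect_eq) (metis (no_types, lifting))
        then show "y \<in> fibre LU LV HC w" unfolding fibre_def using y by simp
      qed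
    qed
    finally show "b \<le> measure (pow LV) (fibre LU LV HC w)" .
  qed
  then show ?thesis unfolding hit_def HB_def HC_def L LU_def[symmetric] .
qed

lemma measure_sample_reindex:
  assumes "inj_on g K" "g \<in> K \<rightarrow> L"
    and "finite T" "\<And>t r. t \<in> T \<Longrightarrow> r \<in> S \<Longrightarrow> h t r \<in> K" "D \<in> sets (pow S)"
  shows "measure (pow L) {w \<in> space (pow L). \<exists>t\<in>T. (\<lambda>r\<in>S. w (g (h t r))) \<in> D}
       = measure (pow K) {v \<in> space (pow K). \<exists>t\<in>T. (\<lambda>r\<in>S. v (h t r)) \<in> D}"
proof -
  let ?Q = "{v \<in> space (pow K). \<exists>t\<in>T. (\<lambda>r\<in>S. v (h t r)) \<in> D}"
  have Q: "?Q \<in> sets (pow K)" using assms(3-5) by (rule sets_sample)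
  have eq: "(\<lambda>r\<in>S. (\<lambda>i\<in>K. w (g i)) (h t r)) = (\<lambda>r\<in>S. w (g (h t r)))" if "t \<in> T" for t w
    using assms(4)[OF that] by (auto simp: fun_eq_iff)
  have sp: "(\<lambda>i\<in>K. w (g i)) \<in> space (pow K)" if "w \<in> space (pow L)" for w
    using that assms(2) by (auto simp: space_PiM PiE_def Pi_def)
  have "{w \<in> space (pow L). \<exists>t\<in>T. (\<lambda>r\<in>S. w (g (h t r))) \<in> D}
      = {w \<in> space (pow L). (\<lambda>i\<in>K. w (g i)) \<in> ?Q}"
  proof (intro Collect_cong conj_cong refl)
    fix w assume "w \<in> space (pow L)"
    then show "(\<exists>t\<in>T. (\<lambda>r\<in>S. w (g (h t r))) \<in> D) \<longleftrightarrow> (\<lambda>i\<in>K. w (g i)) \<in> ?Q"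
      by (simp only: mem_Collect_eq sp eq simp_thms cong: bex_cong)
  qed
  then show ?thesis using measure_reindex[OF assms(1,2) Q] by simp
qed

text \<open>Union bound over the chunks of length \<open>b\<close> from which the \<open>card S\<close> coordinates are drawn; each term
  is a reindexed copy of \<open>hit S b D\<close>.\<close>

lemma hit_chunks_le:
  assumes "finite S" "D \<in> sets (pow S)" "b \<ge> 1"
  shows "hit S (c * b) D \<le> real c ^ card S * hit S b D"
proof -
  define L where "L = S \<times> {1..c * b}"
  define Q where "Q = S \<rightarrow>\<^sub>E {..<c}"
  define T where "T = S \<rightarrow>\<^sub>E {1..b}"
  define H where "H q = {w \<in> space (pow L). \<exists>s\<in>T. (\<lambda>r\<in>S. w (r, q r * b + s r)) \<in> D}" for q
  interpret P: prob_space "pow L" by (rule prob_space_pow)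
  have finT: "finite T" "finite Q"
    unfolding T_def Q_def using assms(1) by (auto intro: finite_PiE)
  have cardQ: "card Q = c ^ card S"
    unfolding Q_def using assms(1) by (simp add: card_PiE)
  have rng: "q * b + s \<in> {1..c * b}" if "q < c" "s \<in> {1..b}" for q s :: nat
  proof -
    have "Suc q * b \<le> c * b" using that(1) by (intro mult_le_mono1) simp
    then show ?thesis using that(2) by auto
  qed
  have H: "H q \<in> P.events" "P.prob (H q) = hit S b D" if q: "q \<in> Q" for q
  proof -
    have q': "q r < c" if "r \<in> S" for r using q that unfolding Q_def by auto
    show "H q \<in> P.events"
      unfolding H_def using finT(1) assms(2) rng q'
      by (intro sets_sample) (auto simp: L_def T_def PiE_def Pi_def)
    define g where "g = (\<lambda>(r, s). (r, q r * b + s))"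
    have inj: "inj_on g (S \<times> {1..b})" unfolding g_def by (auto simp: inj_on_def)
    have gL: "g \<in> S \<times> {1..b} \<rightarrow> L" unfolding g_def L_def using rng q' by auto
    have "H q = {w \<in> space (pow L). \<exists>s\<in>T. (\<lambda>r\<in>S. w (g (r, s r))) \<in> D}"
      unfolding H_def g_def by simp
    then show "P.prob (H q) = hit S b D"
      unfolding hit_def T_def[symmetric]
      using measure_sample_reindex[OF inj gL finT(1) _ assms(2), of "\<lambda>s r. (r, s r)"]
      by (auto simp: T_def PiE_def Pi_def)
  qed
  have "{w \<in> space (pow L). \<exists>t\<in>S \<rightarrow>\<^sub>E {1..c * b}. (\<lambda>r\<in>S. w (r, t r)) \<in> D} \<subseteq> (\<Union>q\<in>Q. H q)"
  proof
    fix w assume "w \<in> {w \<in> space (pow L). \<exists>t\<in>S \<rightarrow>\<^sub>E {1..c * b}. (\<lambda>r\<in>S. w (r, t r)) \<in> D}"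
    then obtain t where w: "w \<in> space (pow L)" and t: "t \<in> S \<rightarrow>\<^sub>E {1..c * b}"
      and D: "(\<lambda>r\<in>S. w (r, t r)) \<in> D" by blast
    define q where "q = (\<lambda>r\<in>S. (t r - 1) div b)"
    define s where "s = (\<lambda>r\<in>S. (t r - 1) mod b + 1)"
    have tr: "1 \<le> t r" "t r \<le> c * b" if "r \<in> S" for r using t that by auto
    have "q \<in> Q"
    proof -
      have "(t r - 1) div b < c" if "r \<in> S" for r
        using tr[OF that] \<open>b \<ge> 1\<close> by (intro less_mult_imp_div_less) linarith
      then show ?thesis unfolding q_def Q_def by auto
    qed
    moreover have "s \<in> T" unfolding s_def T_def using \<open>b \<ge> 1\<close> by (auto simp: Suc_le_eq)
    moreover have "q r * b + s r = t r" if "r \<in> S" for r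
      using tr[OF that] that div_mult_mod_eq[of "t r - 1" b] unfolding q_def s_def by simp
    then have "(\<lambda>r\<in>S. w (r, q r * b + s r)) = (\<lambda>r\<in>S. w (r, t r))"
      by (auto simp: fun_eq_iff)
    ultimately show "w \<in> (\<Union>q\<in>Q. H q)"
      using w D unfolding H_def by force
  qed
  then have "hit S (c * b) D \<le> P.prob (\<Union>q\<in>Q. H q)"
    unfolding hit_def L_def[symmetric]
    using H(1) finT(2) by (intro P.finite_measure_mono) auto
  also have "\<dots> \<le> (\<Sum>q\<in>Q. P.prob (H q))"
    using H(1) finT(2) by (intro P.finite_measure_subadditive_finite) auto
  also have "\<dots> = real c ^ card S * hit S b D"
    using H(2) cardQ by simp
  finally show ?thesis .
qed

lemma finite_incr_indices: "finite (incr_indices l n)"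
proof -
  have "finite ({1..l} \<rightarrow>\<^sub>E {1..n})" by (intro finite_PiE) auto
  then show ?thesis unfolding incr_indices_def by simp
qed

text \<open>The private sample of coordinate \<open>r\<close> is realised as the \<open>r\<close>-th block of length \<open>b\<close> of a single
  sample. Choices from consecutive blocks are automatically increasing.\<close>

lemma hit_blocks_le:
  assumes "A \<in> sets (pow {1..d})" "d * b \<le> n"
  shows "hit {1..d} b A
    \<le> measure (pow {1..n}) {w \<in> space (pow {1..n}). \<exists>i\<in>incr_indices d n. (\<lambda>r\<in>{1..d}. w (i r)) \<in> A}"
proof -
  define T where "T = {1..d} \<rightarrow>\<^sub>E {1..b}"
  define g where "g = (\<lambda>(r, s). (r - 1) * b + s)"
  interpret P: prob_space "pow {1..n}" by (rule prob_space_pow)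
  have finT: "finite T" unfolding T_def by (intro finite_PiE) auto
  have lt: "(r - 1) * b + s < (r' - 1) * b + s'"
    if "1 \<le> r" "r < r'" "s \<in> {1..b}" "s' \<in> {1..b}" for r r' s s' :: nat
  proof -
    have "r * b \<le> (r' - 1) * b" using that by (intro mult_le_mono1) linarith
    moreover have "(r - 1) * b + b = r * b"
      using that(1) by (cases r) auto
    ultimately show ?thesis using that(3,4) by (simp only: atLeastAtMost_iff) linarith
  qed
  have inj: "inj_on g ({1..d} \<times> {1..b})"
  proof (rule inj_onI, clarify)
    fix r s r' s'
    assume *: "g (r, s) = g (r', s')" and r: "r \<in> {1..d}" "r' \<in> {1..d}" and s: "s \<in> {1..b}" "s' \<in> {1..b}"
    have "r = r'"
      using * lt[of r r' s s'] lt[of r' r s' s] r s unfolding g_def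
      by (cases r r' rule: linorder_cases) auto
    then show "r = r' \<and> s = s'" using * unfolding g_def by simp
  qed
  have rng: "g (r, s) \<in> {1..n}" if "r \<in> {1..d}" "s \<in> {1..b}" for r s
  proof -
    have "(r - 1) * b + b = r * b" using that(1) by (cases r) auto
    moreover have "r * b \<le> d * b" using that(1) by (intro mult_le_mono1) auto
    ultimately have "(r - 1) * b + s \<le> n"
      using that(2) assms(2) by (simp only: atLeastAtMost_iff) linarith
    then show ?thesis using that(2) unfolding g_def by simp
  qed
  have "hit {1..d} b A = measure (pow {1..n})
      {w \<in> space (pow {1..n}). \<exists>t\<in>T. (\<lambda>r\<in>{1..d}. w (g (r, t r))) \<in> A}"
    unfolding hit_def T_def[symmetric]
    using inj rng finT assms(1)
    by (intro measure_sample_reindex[symmetric]) (auto simp: T_def PiE_def Pi_def)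
  also have "\<dots> \<le> measure (pow {1..n})
      {w \<in> space (pow {1..n}). \<exists>i\<in>incr_indices d n. (\<lambda>r\<in>{1..d}. w (i r)) \<in> A}"
  proof (rule P.finite_measure_mono)
    show "{w \<in> space (pow {1..n}). \<exists>i\<in>incr_indices d n. (\<lambda>r\<in>{1..d}. w (i r)) \<in> A} \<in> P.events"
      using assms(1) by (intro sets_sample finite_incr_indices) (auto simp: incr_indices_def PiE_def Pi_def)
    show "{w \<in> space (pow {1..n}). \<exists>t\<in>T. (\<lambda>r\<in>{1..d}. w (g (r, t r))) \<in> A}
      \<subseteq> {w \<in> space (pow {1..n}). \<exists>i\<in>incr_indices d n. (\<lambda>r\<in>{1..d}. w (i r)) \<in> A}"
    proof
      fix w assume "w \<in> {w \<in> space (pow {1..n}). \<exists>t\<in>T. (\<lambda>r\<in>{1..d}. w (g (r, t r))) \<in> A}"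
      then obtain t where w: "w \<in> space (pow {1..n})" and t: "t \<in> T"
        and A: "(\<lambda>r\<in>{1..d}. w (g (r, t r))) \<in> A" by blast
      define i where "i = (\<lambda>r\<in>{1..d}. g (r, t r))"
      have tr: "t r \<in> {1..b}" if "r \<in> {1..d}" for r using t that unfolding T_def by auto
      have "i \<in> incr_indices d n"
        unfolding incr_indices_def
      proof (intro CollectI conjI)
        show "i \<in> {1..d} \<rightarrow>\<^sub>E {1..n}" unfolding i_def using rng tr by simp
        show "strict_mono_on {1..d} i"
        proof (rule strict_mono_onI)
          fix r r' assume r: "r \<in> {1..d}" "r' \<in> {1..d}" "r < r'"
          then show "i r < i r'"
            using lt[of r r' "t r" "t r'"] tr[OF r(1)] tr[OF r(2)] unfolding i_def g_def by auto
        qed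
      qed
      moreover have "(\<lambda>r\<in>{1..d}. w (i r)) = (\<lambda>r\<in>{1..d}. w (g (r, t r)))"
        unfolding i_def by (auto simp: fun_eq_iff)
      ultimately have "\<exists>i\<in>incr_indices d n. (\<lambda>r\<in>{1..d}. w (i r)) \<in> A"
        using A by (intro bexI[of _ i]) simp_all
      then show "w \<in> {w \<in> space (pow {1..n}). \<exists>i\<in>incr_indices d n. (\<lambda>r\<in>{1..d}. w (i r)) \<in> A}"
        using w by blast
    qed
  qed
  finally show ?thesis .
qed

text \<open>The colouring \<open>f\<close> hands the \<open>m\<close>-th draw to coordinate \<open>f m\<close>; index choices that respect the
  colouring become choices from private samples.\<close>

lemma coloured_le_hit:
  assumes "finite I" "B \<in> sets (pow I)" "f \<in> {1..n} \<rightarrow>\<^sub>E I"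
    and T: "T \<subseteq> {j \<in> I \<rightarrow>\<^sub>E {1..n}. \<forall>i\<in>I. f (j i) = i}"
  shows "measure (pow {1..n}) {w \<in> space (pow {1..n}). \<exists>j\<in>T. (\<lambda>i\<in>I. w (j i)) \<in> B} \<le> hit I n B"
proof -
  define L where "L = I \<times> {1..n}"
  interpret P: prob_space "pow L" by (rule prob_space_pow)
  have "finite {j \<in> I \<rightarrow>\<^sub>E {1..n}. \<forall>i\<in>I. f (j i) = i}"
    using assms(1) by (intro finite_subset[OF _ finite_PiE[of I "\<lambda>_. {1..n}"]]) auto
  with T have finT: "finite T" by (rule finite_subset)
  have "measure (pow {1..n}) {w \<in> space (pow {1..n}). \<exists>j\<in>T. (\<lambda>i\<in>I. w (j i)) \<in> B}
      = measure (pow L) {w \<in> space (pow L). \<exists>j\<in>T. (\<lambda>i\<in>I. w (f (j i), j i)) \<in> B}"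
    using finT T assms(2,3)
    by (intro measure_sample_reindex[of "\<lambda>m. (f m, m)", symmetric])
       (auto simp: inj_on_def L_def PiE_def Pi_def)
  also have "\<dots> \<le> hit I n B"
    unfolding hit_def L_def[symmetric]
  proof (rule P.finite_measure_mono)
    show "{w \<in> space (pow L). \<exists>t\<in>I \<rightarrow>\<^sub>E {1..n}. (\<lambda>r\<in>I. w (r, t r)) \<in> B} \<in> P.events"
      unfolding L_def using assms(1,2) by (rule hit_sets)
    have "(\<lambda>i\<in>I. w (f (j i), j i)) = (\<lambda>i\<in>I. w (i, j i))" if "j \<in> T" for j and w :: "_ \<Rightarrow> 'e"
      using that T by (auto simp: fun_eq_iff)
    then show "{w \<in> space (pow L). \<exists>j\<in>T. (\<lambda>i\<in>I. w (f (j i), j i)) \<in> B}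
       \<subseteq> {w \<in> space (pow L). \<exists>t\<in>I \<rightarrow>\<^sub>E {1..n}. (\<lambda>r\<in>I. w (r, t r)) \<in> B}"
      using T by (auto 0 3)
  qed
  finally show ?thesis .
qed

text \<open>An injective index choice respects a uniformly random colouring of \<open>{1..n}\<close> by \<open>I\<close> with probability
  \<open>l\<^sup>-\<^sup>l\<close>, where \<open>l = card I\<close>. Averaging the preceding bound over all colourings therefore loses the
  factor \<open>l\<^sup>l\<close>.\<close>

lemma inj_le_hit:
  assumes "finite I" "I \<noteq> {}" "B \<in> sets (pow I)"
    and T: "T \<subseteq> {j \<in> I \<rightarrow>\<^sub>E {1..n}. inj_on j I}"
  shows "measure (pow {1..n}) {w \<in> space (pow {1..n}). \<exists>j\<in>T. (\<lambda>i\<in>I. w (j i)) \<in> B}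
       \<le> real (card I) ^ card I * hit I n B"
proof (cases "n < card I")
  case True
  have "hit I n B \<ge> 0" unfolding hit_def by simp
  have "T = {}"
  proof (rule ccontr)
    assume "T \<noteq> {}"
    then obtain j where "inj_on j I" "j \<in> I \<rightarrow>\<^sub>E {1..n}" using T by blast
    then have "card I \<le> card {1..n}"
      by (intro card_inj_on_le[of j]) auto
    then show False using True by simp
  qed
  then show ?thesis using \<open>hit I n B \<ge> 0\<close> by simp
next
  case False
  define l where "l = card I"
  have l: "l \<ge> 1" "l \<le> n" using False assms(1,2) unfolding l_def by (auto simp: Suc_le_eq card_gt_0_iff)
  define F where "F = {1..n} \<rightarrow>\<^sub>E I"
  define Tf where "Tf f = {j \<in> T. \<forall>i\<in>I. f (j i) = i}" for f
  define E where "E = {w \<in> space (pow {1..n}). \<exists>j\<in>T. (\<lambda>i\<in>I. w (j i)) \<in> B}"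
  define Ef where "Ef f = {w \<in> space (pow {1..n}). \<exists>j\<in>Tf f. (\<lambda>i\<in>I. w (j i)) \<in> B}" for f
  interpret P: prob_space "pow {1..n}" by (rule prob_space_pow)
  have "finite (I \<rightarrow>\<^sub>E {1..n})" using assms(1) by (intro finite_PiE) auto
  then have finT: "finite T" using T by (auto intro: finite_subset)
  have finF: "finite F" unfolding F_def using assms(1) by (intro finite_PiE) auto
  have cardF: "card F = l ^ n" unfolding F_def l_def by (simp add: card_PiE)
  have jT: "j i \<in> {1..n}" if "j \<in> T" "i \<in> I" for j i
    using that T by blast
  have Es: "E \<in> P.events"
    unfolding E_def using finT jT assms(3) by (intro sets_sample)
  have Efs: "Ef f \<in> P.events" for f
    unfolding Ef_def using finT jT assms(3) by (intro sets_sample) (simp_all add: Tf_def)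
  have Efle: "P.prob (Ef f) \<le> hit I n B" if "f \<in> F" for f
  proof -
    have "Tf f \<subseteq> {j \<in> I \<rightarrow>\<^sub>E {1..n}. \<forall>i\<in>I. f (j i) = i}"
      unfolding Tf_def using T by blast
    with that show ?thesis
      unfolding Ef_def F_def by (intro coloured_le_hit[OF assms(1,3)])
  qed
  have cnt: "card {f \<in> F. \<forall>i\<in>I. f (j i) = i} \<ge> l ^ (n - l)"
    if j: "j \<in> T" for j
  proof -
    have j': "inj_on j I" "j ` I \<subseteq> {1..n}" using j T by auto
    \<comment> \<open>The colours of the \<open>l\<close> chosen indices are forced, all others are free.\<close>
    let ?G = "\<lambda>m. if m \<in> j ` I then {inv_into I j m} else I"
    have "PiE {1..n} ?G \<subseteq> {f \<in> F. \<forall>i\<in>I. f (j i) = i}"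
    proof
      fix f assume f: "f \<in> PiE {1..n} ?G"
      have "f (j i) = i" if "i \<in> I" for i
      proof -
        have "f (j i) \<in> ?G (j i)" using f j'(2) that by (intro PiE_mem[OF f]) auto
        then show ?thesis using that j'(1) by simp
      qed
      moreover have "f \<in> F"
        unfolding F_def
      proof (rule PiE_I)
        fix m assume "m \<in> {1..n}"
        then have "f m \<in> ?G m" by (rule PiE_mem[OF f])
        then show "f m \<in> I" by (auto split: if_splits intro: inv_into_into)
      next
        fix m assume "m \<notin> {1..n}" then show "f m = undefined" by (rule PiE_arb[OF f])
      qed
      ultimately show "f \<in> {f \<in> F. \<forall>i\<in>I. f (j i) = i}" by simp
    qed
    then have "card (PiE {1..n} ?G) \<le> card {f \<in> F. \<forall>i\<in>I. f (j i) = i}"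
      using finF by (intro card_mono) auto
    moreover have "card (PiE {1..n} ?G) = l ^ (n - l)"
    proof -
      have "card (PiE {1..n} ?G) = (\<Prod>m\<in>{1..n}. if m \<in> j ` I then 1 else l)"
        by (simp add: card_PiE l_def if_distrib[of card] cong: if_cong)
      also have "\<dots> = (\<Prod>m\<in>{1..n} - j ` I. l)"
        using j'(2) by (intro prod.mono_neutral_cong_right) auto
      also have "\<dots> = l ^ (n - l)"
        using j' assms(1) by (simp add: card_Diff_subset card_image l_def)
      finally show ?thesis .
    qed
    ultimately show ?thesis by simp
  qed
  have pt: "real l ^ (n - l) * indicator E w \<le> (\<Sum>f\<in>F. indicator (Ef f) w)" for w
  proof (cases "w \<in> E")
    case True
    then obtain j where j: "j \<in> T" and jB: "(\<lambda>i\<in>I. w (j i)) \<in> B" and w: "w \<in> space (pow {1..n})"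
      unfolding E_def by blast
    have "real l ^ (n - l) \<le> real (card {f \<in> F. \<forall>i\<in>I. f (j i) = i})"
      using of_nat_mono[OF cnt[OF j], where 'a = real] by simp
    also have "\<dots> = (\<Sum>f\<in>{f \<in> F. \<forall>i\<in>I. f (j i) = i}. indicator (Ef f) w)"
    proof -
      have "w \<in> Ef f" if "\<forall>i\<in>I. f (j i) = i" for f
        using that j jB w unfolding Ef_def Tf_def by blast
      then show ?thesis by simp
    qed
    also have "\<dots> \<le> (\<Sum>f\<in>F. indicator (Ef f) w)"
      using finF by (intro sum_mono2) auto
    finally show ?thesis using True by simp
  next
    case False
    then show ?thesis by (simp add: sum_nonneg)
  qed
  have int1: "integrable (pow {1..n}) (indicator X :: _ \<Rightarrow> real)" if "X \<in> P.events" for X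
    using that P.emeasure_finite[of X] by (intro integrable_real_indicator) (auto simp: less_top)
  have "P.expectation (\<lambda>w. real l ^ (n - l) * indicator E w)
      \<le> P.expectation (\<lambda>w. \<Sum>f\<in>F. indicator (Ef f) w)"
    by (intro integral_mono pt Bochner_Integration.integrable_mult_right
        Bochner_Integration.integrable_sum int1 Es Efs)
  then have "real l ^ (n - l) * P.prob E \<le> (\<Sum>f\<in>F. P.prob (Ef f))"
    using int1 Es Efs by (simp add: Bochner_Integration.integral_sum)
  also have "\<dots> \<le> (\<Sum>f\<in>F. hit I n B)"
    by (intro sum_mono Efle)
  also have "\<dots> = real l ^ (n - l) * (real l ^ l * hit I n B)"
    using l(2) by (simp add: cardF mult.assoc[symmetric] flip: power_add)
  finally show ?thesis
    using l(1) unfolding E_def[symmetric] l_def[symmetric] by simp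
qed

end

section \<open>Iterated sections of the trimmed sets\<close>

lemma C_set_top: "d \<le> l \<Longrightarrow> C_set \<mu> d k A l = A"
  by (subst C_set.simps) simp

lemma C_set_step:
  "l < d \<Longrightarrow> C_set \<mu> d k A l =
     {x \<in> C_set \<mu> d k A (l + 1).
        \<forall>I. I \<subseteq> {1..d} \<and> card I = l \<longrightarrow> restrict x I \<notin> B_set \<mu> d k A I}"
  unfolding B_set_def by (subst C_set.simps) auto

lemma C_set_mono: "l \<le> l' \<Longrightarrow> C_set \<mu> d k A l \<subseteq> C_set \<mu> d k A l'"
proof (induction l' rule: dec_induct)
  case (step n)
  have "C_set \<mu> d k A n \<subseteq> C_set \<mu> d k A (Suc n)"
    by (cases "d \<le> n") (auto simp: C_set_top C_set_step)
  with step.IH show ?case by blast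
qed simp

lemma not_in_C_set:
  assumes "x \<in> A" "x \<notin> C_set \<mu> d k A 1" "d \<ge> 1"
  shows "\<exists>I\<subseteq>{1..d}. card I \<in> {1..d - 1} \<and> restrict x I \<in> B_set \<mu> d k A I"
proof (rule ccontr)
  assume no: "\<not> ?thesis"
  have "x \<in> C_set \<mu> d k A 1"
    using \<open>d \<ge> 1\<close>
  proof (induction rule: inc_induct)
    case base
    show ?case using assms(1) by (simp add: C_set_top)
  next
    case (step l)
    show ?case using step no by (auto simp: C_set_step)
  qed
  with assms(2) show False by simp
qed

context law
begin

lemma merge_in_space:
  assumes "x \<in> space (pow I)" "y \<in> space (pow J)"
  shows "merge I J (x, y) \<in> space (pow (I \<union> J))"
  using assms by (auto simp: space_PiM PiE_def Pi_def merge_def extensional_def)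

lemma slice_eq_fibre:
  assumes "A \<subseteq> space (pow {1..d})" "I \<subseteq> {1..d}" "x \<in> space (pow I)"
  shows "slice \<mu> d A I x = fibre I ({1..d} - I) A x"
proof (intro set_eqI iffI)
  fix z assume "z \<in> slice \<mu> d A I x"
  then obtain a where z: "z \<in> space (pow ({1..d} - I))" and a: "a \<in> A"
    and eq: "restrict a I = x" "restrict a ({1..d} - I) = z"
    unfolding slice_def by (auto simp: space_PiM)
  have "a \<in> extensional {1..d}" using a assms(1) by (auto simp: space_PiM PiE_def)
  then have "merge I ({1..d} - I) (x, z) = a"
    using assms(2) by (auto simp: merge_def eq[symmetric] fun_eq_iff extensional_def)
  then show "z \<in> fibre I ({1..d} - I) A x" using z a unfolding fibre_def by simp
next
  fix z assume "z \<in> fibre I ({1..d} - I) A x"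
  then have z: "z \<in> space (pow ({1..d} - I))" and A: "merge I ({1..d} - I) (x, z) \<in> A"
    unfolding fibre_def by auto
  have "restrict (merge I ({1..d} - I) (x, z)) I = x"
    using assms(3) by (auto simp: merge_def fun_eq_iff space_PiM PiE_def extensional_def)
  moreover have "restrict (merge I ({1..d} - I) (x, z)) ({1..d} - I) = z"
    using z by (auto simp: merge_def fun_eq_iff space_PiM PiE_def extensional_def)
  ultimately show "z \<in> slice \<mu> d A I x"
    using z A unfolding slice_def space_PiM by blast
qed

lemma heavy_eq:
  assumes "C \<in> sets (pow {1..d})" "I \<subseteq> {1..d}"
  shows "heavy \<mu> d k C I = {x \<in> space (pow I).
      1 \<le> 2 ^ (k * (d - card I)) * measure (pow ({1..d} - I)) (fibre I ({1..d} - I) C x)}"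
  using slice_eq_fibre[OF sets.sets_into_space[OF assms(1)] assms(2)]
  unfolding heavy_def by (auto simp: space_PiM)

lemma heavy_sets:
  assumes "C \<in> sets (pow {1..d})" "I \<subseteq> {1..d}"
  shows "heavy \<mu> d k C I \<in> sets (pow I)"
proof -
  have "I \<union> ({1..d} - I) = {1..d}" using assms(2) by auto
  then have [measurable]: "(\<lambda>x. measure (pow ({1..d} - I)) (fibre I ({1..d} - I) C x)) \<in> borel_measurable (pow I)"
    using assms finite_subset[OF assms(2)] by (intro measurable_measure_fibre) auto
  show ?thesis unfolding heavy_eq[OF assms] by measurable
qed

lemma C_set_sets:
  assumes "A \<in> sets (pow {1..d})"
  shows "C_set \<mu> d k A l \<in> sets (pow {1..d})"
proof (cases "l \<le> d")
  case True
  then show ?thesis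
  proof (induction rule: inc_induct)
    case base
    show ?case using assms by (simp add: C_set_top)
  next
    case (step l)
    let ?\<I> = "{I. I \<subseteq> {1..d} \<and> card I = l}"
    let ?H = "\<lambda>I. (\<lambda>x. restrict x I) -` heavy \<mu> d k (C_set \<mu> d k A (Suc l)) I \<inter> space (pow {1..d})"
    have "finite ?\<I>" by (rule finite_subset[of _ "Pow {1..d}"]) auto
    moreover have "?H I \<in> sets (pow {1..d})" if "I \<in> ?\<I>" for I
      using that step.IH by (intro measurable_sets[OF measurable_restrict_subset] heavy_sets) auto
    ultimately have "C_set \<mu> d k A (Suc l) - (\<Union>I\<in>?\<I>. ?H I) \<in> sets (pow {1..d})"
      using step.IH by (intro sets.Diff sets.finite_UN)
    also have "C_set \<mu> d k A (Suc l) - (\<Union>I\<in>?\<I>. ?H I) = C_set \<mu> d k A l"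
    proof -
      have "C_set \<mu> d k A (Suc l) \<subseteq> space (pow {1..d})"
        using step.IH by (rule sets.sets_into_space)
      then show ?thesis
        using step.hyps(2) by (auto simp: C_set_step B_set_def)
    qed
    finally show ?case .
  qed
next
  case False
  then show ?thesis using assms by (simp add: C_set_top)
qed

lemma B_set_sets:
  assumes "A \<in> sets (pow {1..d})" "I \<subseteq> {1..d}"
  shows "B_set \<mu> d k A I \<in> sets (pow I)"
  unfolding B_set_def using assms by (intro heavy_sets C_set_sets)

text \<open>If the section at \<open>x\<close> is not empty, then \<open>x\<close> is the restriction of a point of
  \<open>C_set \<mu> d k A l\<close>, hence of one that survived the trimming at level \<open>card J\<close>. So \<open>x\<close> is not heavy for the
  set of level \<open>card J + 1\<close>, which contains \<open>C_set \<mu> d k A l\<close>.\<close>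

lemma fibre_C_set_le:
  assumes A: "A \<in> sets (pow {1..d})" and J: "J \<subseteq> {1..d}" "l \<le> card J" "card J < d"
    and x: "x \<in> space (pow J)"
  shows "2 ^ (k * (d - card J)) * measure (pow ({1..d} - J)) (fibre J ({1..d} - J) (C_set \<mu> d k A l) x) \<le> 1"
proof (cases "fibre J ({1..d} - J) (C_set \<mu> d k A l) x = {}")
  case True
  then show ?thesis by simp
next
  case False
  interpret P: prob_space "pow ({1..d} - J)" by (rule prob_space_pow)
  let ?F = "\<lambda>l. fibre J ({1..d} - J) (C_set \<mu> d k A l) x"
  have U: "J \<union> ({1..d} - J) = {1..d}" using J(1) by auto
  obtain y where y: "y \<in> ?F l" using False by blast
  define a where "a = merge J ({1..d} - J) (x, y)"
  have "a \<in> C_set \<mu> d k A l" using y unfolding a_def fibre_def by simp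
  then have "a \<in> C_set \<mu> d k A (card J)" using C_set_mono[OF J(2)] by blast
  then have "restrict a J \<notin> B_set \<mu> d k A J" using J(1,3) by (auto simp: C_set_step)
  moreover have "restrict a J = x"
    using x unfolding a_def by (auto simp: merge_def fun_eq_iff space_PiM PiE_def extensional_def)
  ultimately have "2 ^ (k * (d - card J)) * P.prob (?F (card J + 1)) \<le> 1"
    using x unfolding B_set_def heavy_eq[OF C_set_sets[OF A] J(1)] by auto
  moreover have "P.prob (?F l) \<le> P.prob (?F (card J + 1))"
  proof (rule P.finite_measure_mono)
    show "?F l \<subseteq> ?F (card J + 1)"
      using C_set_mono[of l "card J + 1" \<mu> d k A] J(2) unfolding fibre_def by auto
    show "?F (card J + 1) \<in> P.events"
      using C_set_sets[OF A] x U by (intro fibre_sets) auto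
  qed
  then have "2 ^ (k * (d - card J)) * P.prob (?F l) \<le> 2 ^ (k * (d - card J)) * P.prob (?F (card J + 1))"
    by (intro mult_left_mono) auto
  ultimately show ?thesis by linarith
qed

lemma fibre_fibre:
  assumes "I \<inter> V = {}" "J \<subseteq> V" "y \<in> space (pow J)"
  shows "fibre J (V - J) (fibre I V C x) y = fibre (I \<union> J) (V - J) C (merge I J (x, y))"
proof -
  have eq: "merge I V (x, merge J (V - J) (y, z)) = merge (I \<union> J) (V - J) (merge I J (x, y), z)" for z
    using assms(1,2) by (auto simp: merge_def fun_eq_iff)
  have "merge J (V - J) (y, z) \<in> space (pow V)" if "z \<in> space (pow (V - J))" for z
    using merge_in_space[OF assms(3) that] assms(2) by (simp add: Un_absorb1)
  then show ?thesis unfolding fibre_def by (auto simp: eq)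
qed

lemma hit_C_set_ge:
  assumes A: "A \<in> sets (pow {1..d})" and "d \<ge> 1"
    and m: "m = 2 ^ (k * d) * measure (pow {1..d}) (C_set \<mu> d k A 1)"
  shows "m / (m + 2 ^ d) \<le> hit {1..d} (2 ^ k) (C_set \<mu> d k A 1)"
proof -
  have "m / (m + 2 ^ card {1..d}) \<le> hit {1..d} (2 ^ k) (C_set \<mu> d k A 1)"
  proof (rule hit_ge)
    fix J x assume J: "J \<subseteq> {1..d}" "J \<noteq> {}" "J \<noteq> {1..d}" and x: "x \<in> space (pow J)"
    have fJ: "finite J" using J(1) finite_subset by blast
    have "card J < d" using psubset_card_mono[of "{1..d}" J] J by auto
    moreover have "1 \<le> card J" using fJ J(2) by (simp add: Suc_le_eq card_gt_0_iff)
    ultimately show "real (2 ^ k) ^ card ({1..d} - J) *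
        measure (pow ({1..d} - J)) (fibre J ({1..d} - J) (C_set \<mu> d k A 1) x) \<le> 1"
      using fibre_C_set_le[OF A J(1) _ _ x, of 1 k] fJ J(1)
      by (simp add: card_Diff_subset power_mult)
  qed (use assms C_set_sets[OF A] in \<open>auto simp: power_mult\<close>)
  then show ?thesis by simp
qed

text \<open>At a point \<open>x\<close> of \<open>B_set \<mu> d k A I\<close> the section of the set of level \<open>card I + 1\<close> has at least one expected
  hit, and its own sections at nonempty proper \<open>J\<close> are sections of that set at \<open>I \<union> J\<close>, where the trimming
  applies because \<open>card (I \<union> J) \<ge> card I + 1\<close>. Thus \<open>hit_ge\<close> holds with \<open>m \<ge> 1\<close>.\<close>

lemma hit_B_set_le:
  assumes A: "A \<in> sets (pow {1..d})" and I: "I \<subseteq> {1..d}" "card I < d"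
  shows "1 / (1 + 2 ^ d) * hit I (2 ^ k) (B_set \<mu> d k A I)
    \<le> hit {1..d} (2 ^ k) (C_set \<mu> d k A (card I + 1))"
proof -
  define V where "V = {1..d} - I"
  define C where "C = C_set \<mu> d k A (card I + 1)"
  have fI: "finite I" using I(1) finite_subset by blast
  have U: "I \<union> V = {1..d}" and disj: "I \<inter> V = {}" and fV: "finite V"
    using I(1) unfolding V_def by auto
  have cV: "card V = d - card I" unfolding V_def using fI I(1) by (simp add: card_Diff_subset)
  have Vne: "V \<noteq> {}" using cV I(2) by auto
  have Cs: "C \<in> sets (pow (I \<union> V))" unfolding C_def U by (rule C_set_sets[OF A])
  have "1 / (1 + 2 ^ d) * hit I (2 ^ k) (B_set \<mu> d k A I) \<le> hit (I \<union> V) (2 ^ k) C"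
  proof (rule hit_fibre_ge[OF disj fI fV Cs B_set_sets[OF A I(1)]])
    fix x assume xB: "x \<in> B_set \<mu> d k A I"
    define m where "m = 2 ^ (k * (d - card I)) * measure (pow V) (fibre I V C x)"
    have x: "x \<in> space (pow I)" and m1: "1 \<le> m"
      using xB unfolding B_set_def heavy_eq[OF C_set_sets[OF A] I(1)] m_def V_def C_def by auto
    have "m / (m + 2 ^ card V) \<le> hit V (2 ^ k) (fibre I V C x)"
    proof (rule hit_ge[OF fV Vne fibre_sets[OF Cs x]])
      fix J y assume J: "J \<subseteq> V" "J \<noteq> {}" "J \<noteq> V" and y: "y \<in> space (pow J)"
      have fJ: "finite J" using J(1) fV finite_subset by blast
      have cIJ: "card (I \<union> J) = card I + card J"
        using fI fJ disj J(1) by (intro card_Un_disjoint) auto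
      have cJ: "card J < card V" "1 \<le> card J"
        using psubset_card_mono[OF fV, of J] J fJ by (auto simp: Suc_le_eq card_gt_0_iff)
      have VJ: "{1..d} - (I \<union> J) = V - J" unfolding V_def by auto
      have IJ: "I \<union> J \<subseteq> {1..d}" using I(1) J(1) U by auto
      have "2 ^ (k * (d - card (I \<union> J))) * measure (pow (V - J)) (fibre (I \<union> J) (V - J) C (merge I J (x, y))) \<le> 1"
        using fibre_C_set_le[OF A IJ, of "card I + 1" "merge I J (x, y)" k] cIJ cJ cV merge_in_space[OF x y]
        unfolding VJ C_def by simp
      moreover have "real (2 ^ k) ^ card (V - J) = 2 ^ (k * (d - card (I \<union> J)))"
        using fJ J(1) cV cIJ by (simp add: card_Diff_subset power_mult)
      ultimately show "real (2 ^ k) ^ card (V - J) *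
          measure (pow (V - J)) (fibre J (V - J) (fibre I V C x) y) \<le> 1"
        unfolding fibre_fibre[OF disj J(1) y] by simp
    qed (auto simp: m_def cV power_mult)
    moreover have "1 / (1 + 2 ^ d) \<le> m / (m + 2 ^ card V)"
    proof -
      have "(2::real) ^ card V \<le> 2 ^ d" using cV by (intro power_increasing) auto
      also have "\<dots> \<le> m * 2 ^ d" using m1 by simp
      finally show ?thesis using m1 by (simp add: field_simps add_pos_pos)
    qed
    ultimately show "1 / (1 + 2 ^ d) \<le> hit V (2 ^ k) (fibre I V C x)" by linarith
  qed simp
  then show ?thesis unfolding U C_def .
qed

end

section \<open>Coupled and decoupled index families\<close>

text \<open>The position of \<open>i\<close> in the increasing enumeration of \<open>I\<close>, as used by \<open>relabel\<close>.\<close>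

definition rank_in :: "nat set \<Rightarrow> nat \<Rightarrow> nat" where
  "rank_in I i = card {i' \<in> I. i' \<le> i}"

lemma rank_in_strict_mono:
  assumes "finite I"
  shows "strict_mono_on I (rank_in I)"
proof (rule strict_mono_onI)
  fix i i' assume "i \<in> I" "i' \<in> I" "i < i'"
  then have "{r \<in> I. r \<le> i} \<subseteq> {r \<in> I. r \<le> i'}" "i' \<in> {r \<in> I. r \<le> i'} - {r \<in> I. r \<le> i}"
    by auto
  then have "{r \<in> I. r \<le> i} \<subset> {r \<in> I. r \<le> i'}" by blast
  then show "rank_in I i < rank_in I i'"
    unfolding rank_in_def using assms by (intro psubset_card_mono) auto
qed

lemma rank_in_bij:
  assumes "finite I"
  shows "bij_betw (rank_in I) I {1..card I}"
proof -
  have inj: "inj_on (rank_in I) I"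
    using rank_in_strict_mono[OF assms] by (rule strict_mono_on_imp_inj_on)
  have "rank_in I i \<in> {1..card I}" if "i \<in> I" for i
  proof -
    have "{i' \<in> I. i' \<le> i} \<noteq> {}" using that by auto
    then have "0 < card {i' \<in> I. i' \<le> i}" using assms by (simp add: card_gt_0_iff)
    moreover have "card {i' \<in> I. i' \<le> i} \<le> card I" using assms by (intro card_mono) auto
    ultimately show ?thesis unfolding rank_in_def by simp
  qed
  then have "rank_in I ` I \<subseteq> {1..card I}" by auto
  moreover have "card (rank_in I ` I) = card {1..card I}" using inj by (simp add: card_image)
  ultimately have "rank_in I ` I = {1..card I}" by (intro card_subset_eq) auto
  with inj show ?thesis unfolding bij_betw_def by simp
qed

text \<open>Increasing multiindices indexed by \<open>I\<close> itself instead of \<open>{1..card I}\<close>; with them the relabelling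
  disappears and restricting to a subset of coordinates is plain restriction of functions.\<close>

definition incr_maps :: "nat set \<Rightarrow> nat \<Rightarrow> (nat \<Rightarrow> nat) set" where
  "incr_maps I n = {j \<in> I \<rightarrow>\<^sub>E {1..n}. strict_mono_on I j}"

lemma incr_maps_atLeastAtMost: "incr_maps {1..d} n = incr_indices d n"
  unfolding incr_maps_def incr_indices_def ..

lemma finite_incr_maps: "finite I \<Longrightarrow> finite (incr_maps I n)"
  unfolding incr_maps_def
  by (rule finite_subset[of _ "I \<rightarrow>\<^sub>E {1..n}"]) (auto intro: finite_PiE)

lemma incr_maps_eq_image:
  assumes "finite I"
  shows "incr_maps I n = (\<lambda>j. \<lambda>i\<in>I. j (rank_in I i)) ` incr_indices (card I) n"
proof (intro set_eqI iffI)
  let ?e = "inv_into I (rank_in I)"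
  note bij = rank_in_bij[OF assms]
  fix t assume t: "t \<in> incr_maps I n"
  have e: "?e r \<in> I" "rank_in I (?e r) = r" if "r \<in> {1..card I}" for r
    using bij_betw_imp_surj_on[OF bij] that by (auto intro: inv_into_into f_inv_into_f)
  have einv: "?e (rank_in I i) = i" if "i \<in> I" for i
    using bij that by (intro inv_into_f_f) (auto simp: bij_betw_def)
  define j where "j = (\<lambda>r\<in>{1..card I}. t (?e r))"
  have "j \<in> incr_indices (card I) n"
    unfolding incr_indices_def
  proof (intro CollectI conjI strict_mono_onI)
    show "j \<in> {1..card I} \<rightarrow>\<^sub>E {1..n}"
      unfolding j_def using e(1) t by (auto simp: incr_maps_def PiE_def Pi_def)
    fix r r' assume r: "r \<in> {1..card I}" "r' \<in> {1..card I}" "r < r'"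
    have "?e r < ?e r'"
    proof (rule ccontr)
      assume "\<not> ?e r < ?e r'"
      then have "rank_in I (?e r') \<le> rank_in I (?e r)"
        using strict_mono_on_leD[OF rank_in_strict_mono[OF assms] e(1)[OF r(2)] e(1)[OF r(1)]] by simp
      then show False using e(2)[OF r(1)] e(2)[OF r(2)] r(3) by simp
    qed
    then show "j r < j r'"
      using t r e(1)[OF r(1)] e(1)[OF r(2)]
      unfolding j_def incr_maps_def by (auto dest: strict_mono_onD)
  qed
  moreover have "t = (\<lambda>i\<in>I. j (rank_in I i))"
    using t bij_betwE[OF bij] einv
    by (auto simp: j_def incr_maps_def fun_eq_iff PiE_def extensional_def)
  ultimately show "t \<in> (\<lambda>j. \<lambda>i\<in>I. j (rank_in I i)) ` incr_indices (card I) n" by blast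
next
  fix t assume "t \<in> (\<lambda>j. \<lambda>i\<in>I. j (rank_in I i)) ` incr_indices (card I) n"
  then obtain j where j: "j \<in> incr_indices (card I) n" and t: "t = (\<lambda>i\<in>I. j (rank_in I i))" by blast
  have r: "rank_in I i \<in> {1..card I}" if "i \<in> I" for i
    using bij_betwE[OF rank_in_bij[OF assms]] that by blast
  have "strict_mono_on I t"
  proof (rule strict_mono_onI)
    fix i i' assume i: "i \<in> I" "i' \<in> I" "i < i'"
    have "j (rank_in I i) < j (rank_in I i')"
    proof (rule strict_mono_onD[of "{1..card I}" j])
      show "strict_mono_on {1..card I} j" using j unfolding incr_indices_def by blast
      show "rank_in I i < rank_in I i'" by (rule strict_mono_onD[OF rank_in_strict_mono[OF assms] i])
    qed (rule r i)+
    then show "t i < t i'" using i t by simp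
  qed
  moreover have "t \<in> I \<rightarrow>\<^sub>E {1..n}"
  proof -
    have "j \<in> {1..card I} \<rightarrow>\<^sub>E {1..n}" using j unfolding incr_indices_def by blast
    then have "j (rank_in I i) \<in> {1..n}" if "i \<in> I" for i using r[OF that] by (rule PiE_mem)
    then show ?thesis unfolding t by simp
  qed
  ultimately show "t \<in> incr_maps I n" unfolding incr_maps_def by simp
qed

context law
begin

definition coupled :: "nat set \<Rightarrow> nat \<Rightarrow> (nat \<Rightarrow> 'e) set \<Rightarrow> real" where
  "coupled I n D = measure (pow {1..n})
     {w \<in> space (pow {1..n}). \<exists>j\<in>incr_maps I n. (\<lambda>i\<in>I. w (j i)) \<in> D}"

lemma coupled_sets:
  assumes "finite I" "D \<in> sets (pow I)"
  shows "{w \<in> space (pow {1..n}). \<exists>j\<in>incr_maps I n. (\<lambda>i\<in>I. w (j i)) \<in> D} \<in> sets (pow {1..n})"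
  using assms
  by (intro sets_sample finite_incr_maps) (auto simp: incr_maps_def PiE_def Pi_def)

lemma coupled_nonneg: "0 \<le> coupled I n D"
  unfolding coupled_def by simp

lemma coupled_le_hit:
  assumes "finite I" "I \<noteq> {}" "B \<in> sets (pow I)"
  shows "coupled I n B \<le> real (card I) ^ card I * hit I n B"
  unfolding coupled_def
  using assms by (intro inj_le_hit) (auto simp: incr_maps_def intro: strict_mono_on_imp_inj_on)

lemma hit_le_coupled:
  assumes "A \<in> sets (pow {1..d})" "b \<ge> 1" "d \<le> c"
  shows "hit {1..d} (c * b) A \<le> real c ^ d * coupled {1..d} (c * b) A"
proof -
  have "hit {1..d} (c * b) A \<le> real c ^ d * hit {1..d} b A"
    using hit_chunks_le[of "{1..d}" A b c] assms by simp
  also have "\<dots> \<le> real c ^ d * coupled {1..d} (c * b) A"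
    unfolding coupled_def incr_maps_atLeastAtMost
    using assms by (intro mult_left_mono hit_blocks_le mult_le_mono1) auto
  finally show ?thesis .
qed

text \<open>A point of \<open>A\<close> outside \<open>C_set \<mu> d k A 1\<close> has a restriction in some \<open>B_set \<mu> d k A I\<close>, and the
  restriction of an increasing multiindex is increasing. The points inside \<open>C_set \<mu> d k A 1\<close> are counted
  by their expected number.\<close>

lemma coupled_le_sum:
  assumes A: "A \<in> sets (pow {1..d})" and "d \<ge> 1"
  shows "coupled {1..d} n A
    \<le> (\<Sum>I\<in>{I. I \<subseteq> {1..d} \<and> card I \<in> {1..d - 1}}. coupled I n (B_set \<mu> d k A I))
      + real n ^ d * measure (pow {1..d}) (C_set \<mu> d k A 1)"
proof -
  interpret P: prob_space "pow {1..n}" by (rule prob_space_pow)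
  define \<I> where "\<I> = {I. I \<subseteq> {1..d} \<and> card I \<in> {1..d - 1}}"
  define C where "C = C_set \<mu> d k A 1"
  define T where "T = incr_maps {1..d} n"
  define H where "H I D = {w \<in> space (pow {1..n}). \<exists>j\<in>incr_maps I n. (\<lambda>i\<in>I. w (j i)) \<in> D}"
    for I and D :: "(nat \<Rightarrow> 'e) set"
  define G where "G t = {w \<in> space (pow {1..n}). (\<lambda>i\<in>{1..d}. w (t i)) \<in> C}" for t :: "nat \<Rightarrow> nat"
  have fin\<I>: "finite \<I>" unfolding \<I>_def by (rule finite_subset[of _ "Pow {1..d}"]) auto
  have finI: "finite I" if "I \<in> \<I>" for I using that finite_subset unfolding \<I>_def by blast
  have Cs: "C \<in> sets (pow {1..d})" unfolding C_def by (rule C_set_sets[OF A])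
  have HB: "H I (B_set \<mu> d k A I) \<in> P.events" if "I \<in> \<I>" for I
    unfolding H_def using that finI[OF that] by (intro coupled_sets B_set_sets A) (auto simp: \<I>_def)
  have HC: "H {1..d} C \<in> P.events"
    unfolding H_def using Cs by (intro coupled_sets) auto
  have sub: "H {1..d} A \<subseteq> (\<Union>I\<in>\<I>. H I (B_set \<mu> d k A I)) \<union> H {1..d} C"
  proof
    fix w assume "w \<in> H {1..d} A"
    then obtain t where w: "w \<in> space (pow {1..n})" and t: "t \<in> incr_maps {1..d} n"
      and xA: "(\<lambda>i\<in>{1..d}. w (t i)) \<in> A" unfolding H_def by blast
    show "w \<in> (\<Union>I\<in>\<I>. H I (B_set \<mu> d k A I)) \<union> H {1..d} C"
    proof (cases "(\<lambda>i\<in>{1..d}. w (t i)) \<in> C")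
      case True
      then show ?thesis using w t unfolding H_def by blast
    next
      case False
      from not_in_C_set[OF xA False[unfolded C_def] \<open>d \<ge> 1\<close>] obtain I
        where I: "I \<subseteq> {1..d}" "card I \<in> {1..d - 1}"
          and B: "restrict (\<lambda>i\<in>{1..d}. w (t i)) I \<in> B_set \<mu> d k A I" by blast
      define j where "j = restrict t I"
      have "j \<in> incr_maps I n"
        using t I(1) unfolding j_def incr_maps_def
        by (auto simp: PiE_def Pi_def intro!: strict_mono_onI dest: strict_mono_onD)
      moreover have "(\<lambda>i\<in>I. w (j i)) = restrict (\<lambda>i\<in>{1..d}. w (t i)) I"
        using I(1) unfolding j_def by (auto simp: fun_eq_iff)
      ultimately have "w \<in> H I (B_set \<mu> d k A I)"
        using B w unfolding H_def by (metis (mono_tags, lifting) mem_Collect_eq)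
      then show ?thesis using I unfolding \<I>_def by blast
    qed
  qed
  have T: "finite T" "card T \<le> n ^ d"
  proof -
    show "finite T" unfolding T_def by (simp add: finite_incr_maps)
    have "card T \<le> card ({1..d} \<rightarrow>\<^sub>E {1..n})"
      unfolding T_def incr_maps_def by (intro card_mono finite_PiE) auto
    then show "card T \<le> n ^ d" by (simp add: card_PiE)
  qed
  have PG: "P.prob (G t) = measure (pow {1..d}) C" if "t \<in> T" for t
    unfolding G_def using that Cs unfolding T_def incr_maps_def
    by (intro measure_reindex) (auto intro: strict_mono_on_imp_inj_on)
  have Gs: "G t \<in> P.events" if "t \<in> T" for t
  proof -
    have "{w \<in> space (pow {1..n}). \<exists>s\<in>{t}. (\<lambda>i\<in>{1..d}. w (s i)) \<in> C} \<in> P.events"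
      using that Cs unfolding T_def incr_maps_def
      by (intro sets_sample) (auto simp: PiE_def Pi_def)
    then show ?thesis unfolding G_def by simp
  qed
  have "P.prob (H {1..d} C) \<le> (\<Sum>t\<in>T. P.prob (G t))"
  proof -
    have "H {1..d} C = (\<Union>t\<in>T. G t)" unfolding H_def G_def T_def by blast
    moreover have "P.prob (\<Union>t\<in>T. G t) \<le> (\<Sum>t\<in>T. P.prob (G t))"
      using T(1) Gs by (intro P.finite_measure_subadditive_finite) auto
    ultimately show ?thesis by simp
  qed
  also have "\<dots> = real (card T) * measure (pow {1..d}) C" using PG by simp
  also have "\<dots> \<le> real n ^ d * measure (pow {1..d}) C"
    using of_nat_mono[OF T(2), where 'a = real] by (intro mult_right_mono) auto
  finally have *: "P.prob (H {1..d} C) \<le> real n ^ d * measure (pow {1..d}) C" .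
  have UB: "(\<Union>I\<in>\<I>. H I (B_set \<mu> d k A I)) \<in> P.events"
    using HB fin\<I> by (intro sets.finite_UN) auto
  have "P.prob (H {1..d} A) \<le> P.prob ((\<Union>I\<in>\<I>. H I (B_set \<mu> d k A I)) \<union> H {1..d} C)"
    using sub UB HC by (intro P.finite_measure_mono) auto
  also have "\<dots> \<le> P.prob (\<Union>I\<in>\<I>. H I (B_set \<mu> d k A I)) + P.prob (H {1..d} C)"
    using UB HC by (rule measure_Un_le)
  also have "P.prob (\<Union>I\<in>\<I>. H I (B_set \<mu> d k A I)) \<le> (\<Sum>I\<in>\<I>. P.prob (H I (B_set \<mu> d k A I)))"
    using HB fin\<I> by (intro P.finite_measure_subadditive_finite) auto
  finally show ?thesis
    using * unfolding coupled_def H_def \<I>_def C_def by linarith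
qed

lemma prob_eq_coupled:
  assumes "prob_space M" and ind: "prob_space.indep_vars M (\<lambda>_. \<mu>) X {1..}"
    and law: "\<And>j. j \<ge> 1 \<Longrightarrow> distr M \<mu> (X j) = \<mu>"
    and "n \<ge> 1" "finite I" "D \<in> sets (pow I)"
  shows "measure M {\<omega> \<in> space M. \<exists>j\<in>incr_indices (card I) n. relabel I (multi X (card I) j \<omega>) \<in> D}
       = coupled I n D"
proof -
  interpret M: prob_space M by fact
  have rv: "X i \<in> M \<rightarrow>\<^sub>M \<mu>" if "i \<in> {1..n}" for i
    using ind that unfolding M.indep_vars_def by auto
  have "M.indep_vars (\<lambda>_. \<mu>) X {1..n}" using ind by (rule M.indep_vars_subset) auto
  then have "distr M (pow {1..n}) (\<lambda>\<omega>. \<lambda>i\<in>{1..n}. X i \<omega>) = PiM {1..n} (\<lambda>i. distr M \<mu> (X i))"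
    using M.indep_vars_iff_distr_eq_PiM'[of "{1..n}" X "\<lambda>_. \<mu>"] rv \<open>n \<ge> 1\<close> by auto
  also have "\<dots> = pow {1..n}" using law by (intro PiM_cong) auto
  finally have d: "distr M (pow {1..n}) (\<lambda>\<omega>. \<lambda>i\<in>{1..n}. X i \<omega>) = pow {1..n}" .
  let ?E = "{w \<in> space (pow {1..n}). \<exists>j\<in>incr_maps I n. (\<lambda>i\<in>I. w (j i)) \<in> D}"
  have m: "(\<lambda>\<omega>. \<lambda>i\<in>{1..n}. X i \<omega>) \<in> M \<rightarrow>\<^sub>M pow {1..n}"
    using rv by (intro measurable_restrict)
  have "coupled I n D = measure (distr M (pow {1..n}) (\<lambda>\<omega>. \<lambda>i\<in>{1..n}. X i \<omega>)) ?E"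
    unfolding coupled_def d ..
  also have "\<dots> = measure M ((\<lambda>\<omega>. \<lambda>i\<in>{1..n}. X i \<omega>) -` ?E \<inter> space M)"
    by (rule measure_distr[OF m coupled_sets[OF assms(5,6)]])
  also have "(\<lambda>\<omega>. \<lambda>i\<in>{1..n}. X i \<omega>) -` ?E \<inter> space M
     = {\<omega> \<in> space M. \<exists>j\<in>incr_maps I n. (\<lambda>i\<in>I. X (j i) \<omega>) \<in> D}"
  proof -
    have "(\<lambda>i\<in>I. (\<lambda>i\<in>{1..n}. X i \<omega>) (j i)) = (\<lambda>i\<in>I. X (j i) \<omega>)"
      if "j \<in> incr_maps I n" for j \<omega>
      using that by (auto simp: incr_maps_def fun_eq_iff PiE_def Pi_def)
    then show ?thesis using measurable_space[OF m] by (auto simp del: restrict_apply)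
  qed
  also have "\<dots> = {\<omega> \<in> space M. \<exists>j\<in>incr_indices (card I) n. relabel I (multi X (card I) j \<omega>) \<in> D}"
  proof -
    have "relabel I (multi X (card I) j \<omega>) = (\<lambda>i\<in>I. X ((\<lambda>i\<in>I. j (rank_in I i)) i) \<omega>)" for j \<omega>
    proof -
      have "rank_in I i \<in> {1..card I}" if "i \<in> I" for i
        using bij_betwE[OF rank_in_bij[OF assms(5)]] that by blast
      then show ?thesis
        unfolding relabel_def multi_def rank_in_def[symmetric] by (auto simp: fun_eq_iff)
    qed
    then show ?thesis unfolding incr_maps_eq_image[OF assms(5)] by simp
  qed
  finally show ?thesis ..
qed

end

lemma relabel_atLeastAtMost: "relabel {1..d} (multi X d j \<omega>) = multi X d j \<omega>"
proof -
  have "card {i' \<in> {1..d}. i' \<le> i} = i" if "i \<in> {1..d}" for i :: nat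
  proof -
    have "{i' \<in> {1..d}. i' \<le> i} = {1..i}" using that by auto
    then show ?thesis by simp
  qed
  then show ?thesis unfolding relabel_def multi_def by (auto simp: fun_eq_iff)
qed

section \<open>Comparison of the series\<close>

lemma summable_on_of_tail_le:
  fixes f g :: "nat \<Rightarrow> real"
  assumes "g summable_on {1..}" "\<And>k. k \<ge> 1 \<Longrightarrow> 0 \<le> f k" "\<And>k. k \<ge> N \<Longrightarrow> f k \<le> K * g k"
  shows "f summable_on {1..}"
proof -
  let ?N = "max 1 N"
  have "(\<lambda>k. K * g k) summable_on {?N..}"
    using assms(1) by (intro summable_on_cmult_right summable_on_subset_banach[OF assms(1)]) auto
  then have "f summable_on {?N..}"
    by (rule summable_on_comparison_test) (use assms in auto)
  moreover have "f summable_on {1..<?N}" by simp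
  ultimately have "f summable_on ({1..<?N} \<union> {?N..})"
    by (intro summable_on_Un_disjoint) auto
  moreover have "{1..<?N} \<union> {?N..} = {1..}" by auto
  ultimately show ?thesis by simp
qed

text \<open>Since \<open>g\<close> is summable it tends to \<open>0\<close>, so eventually \<open>m / (m + c) < 1 / 2\<close>, that is
  \<open>m < c\<close>; from then on \<open>m \<le> 2 c \<cdot> m / (m + c)\<close>.\<close>

lemma summable_on_of_saturated_le:
  fixes m g :: "nat \<Rightarrow> real"
  assumes g: "g summable_on {1..}" and m: "\<And>k. k \<ge> 1 \<Longrightarrow> 0 \<le> m k" and "c > 0"
    and le: "\<And>k. k \<ge> N \<Longrightarrow> m k / (m k + c) \<le> K * g k"
  shows "m summable_on {1..}"
proof -
  have "(\<lambda>k. if k \<in> {1..} then g k else 0) summable_on UNIV \<longleftrightarrow> g summable_on {1..}"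
    by (rule summable_on_cong_neutral) auto
  then have "(\<lambda>k. if k \<in> {1..} then g k else 0) \<longlonglongrightarrow> 0"
    using g by (intro summable_LIMSEQ_zero summable_on_imp_summable) blast
  then have "(\<lambda>k. K * (if k \<in> {1..} then g k else 0)) \<longlonglongrightarrow> K * 0"
    by (rule tendsto_mult_left)
  then have "\<forall>\<^sub>F k in sequentially. K * (if k \<in> {1..} then g k else 0) < 1 / 2"
    by (rule order_tendstoD) simp
  then obtain N' where N': "K * (if k \<in> {1..} then g k else 0) < 1 / 2" if "k \<ge> N'" for k
    unfolding eventually_sequentially by blast
  show ?thesis
  proof (rule summable_on_of_tail_le[OF g m])
    fix k assume k: "max (max 1 N) N' \<le> k"
    then have "K * g k < 1 / 2" and 1: "m k / (m k + c) \<le> K * g k" and 0: "0 \<le> m k"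
      using N'[of k] le[of k] m[of k] by auto
    then have "m k / (m k + c) < 1 / 2" by linarith
    then have "m k \<le> c" using 0 \<open>c > 0\<close> by (simp add: field_simps)
    then have "m k * (m k + c) \<le> m k * (2 * c)" using 0 by (intro mult_left_mono) auto
    then have "m k \<le> 2 * c * (m k / (m k + c))" using 0 \<open>c > 0\<close> by (simp add: field_simps)
    also have "\<dots> \<le> 2 * c * (K * g k)" using 1 \<open>c > 0\<close> by (intro mult_left_mono) auto
    finally show "m k \<le> (2 * c * K) * g k" by (simp add: mult.assoc)
  qed
qed

lemma summable_on_finite_sum:
  fixes f :: "'i \<Rightarrow> nat \<Rightarrow> real"
  assumes "finite J" "\<And>j. j \<in> J \<Longrightarrow> f j summable_on S"
  shows "(\<lambda>k. \<Sum>j\<in>J. f j k) summable_on S"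
  using assms by (induction J) (auto intro: summable_on_add)

theorem theorem3:
  fixes M :: "'w measure" and \<mu> :: "'e measure"
    and X :: "nat \<Rightarrow> 'w \<Rightarrow> 'e" and A :: "nat \<Rightarrow> (nat \<Rightarrow> 'e) set" and d :: nat
  assumes "prob_space M"
    and "prob_space \<mu>"
    and "prob_space.indep_vars M (\<lambda>_. \<mu>) X {1..}"
    and "\<And>j. j \<ge> 1 \<Longrightarrow> distr M \<mu> (X j) = \<mu>"
    and "d \<ge> 1"
    and "\<And>k. k \<ge> 1 \<Longrightarrow> A k \<in> sets (power_measure \<mu> {1..d})"
  shows "(\<lambda>k. \<P>(\<omega> in M. \<exists>i\<in>incr_indices d (2 ^ k). multi X d i \<omega> \<in> A k)) summable_on {1..}
    \<longleftrightarrow>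
      (\<forall>l\<in>{1..d - 1}. \<forall>I. I \<subseteq> {1..d} \<and> card I = l \<longrightarrow>
         (\<lambda>k. \<P>(\<omega> in M. \<exists>j\<in>incr_indices l (2 ^ k).
                   relabel I (multi X l j \<omega>) \<in> B_set \<mu> d k (A k) I)) summable_on {1..}) \<and>
      (\<lambda>k. 2 ^ (k * d) * measure (power_measure \<mu> {1..d}) (C_set \<mu> d k (A k) 1)) summable_on {1..}"
proof -
  interpret law \<mu> unfolding law_def by fact
  define \<I> where "\<I> = {I. I \<subseteq> {1..d} \<and> card I \<in> {1..d - 1}}"
  define P where "P k = coupled {1..d} (2 ^ k) (A k)" for k
  define Q where "Q I k = coupled I (2 ^ k) (B_set \<mu> d k (A k) I)" for I k
  define m where "m k = 2 ^ (k * d) * measure (pow {1..d}) (C_set \<mu> d k (A k) 1)" for k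
  note A = assms(6)
  have fin: "finite I" if "I \<subseteq> {1..d}" for I using that finite_subset by blast
  have fin\<I>: "finite \<I>" unfolding \<I>_def by (rule finite_subset[of _ "Pow {1..d}"]) auto
  have Peq: "\<P>(\<omega> in M. \<exists>i\<in>incr_indices d (2 ^ k). multi X d i \<omega> \<in> A k) = P k" if "k \<ge> 1" for k
    using prob_eq_coupled[OF assms(1,3,4) _ _ A[OF that], of "2 ^ k"]
    unfolding P_def by (simp add: relabel_atLeastAtMost[simplified])
  have Qeq: "\<P>(\<omega> in M. \<exists>j\<in>incr_indices l (2 ^ k).
      relabel I (multi X l j \<omega>) \<in> B_set \<mu> d k (A k) I) = Q I k"
    if "k \<ge> 1" "I \<subseteq> {1..d}" "card I = l" for k I l
    using prob_eq_coupled[OF assms(1,3,4) _ fin[OF that(2)] B_set_sets[OF A[OF that(1)] that(2)], of "2 ^ k"]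
    unfolding Q_def that(3) by simp
  have Psum: "(\<lambda>k. \<P>(\<omega> in M. \<exists>i\<in>incr_indices d (2 ^ k). multi X d i \<omega> \<in> A k)) summable_on {1..}
      \<longleftrightarrow> P summable_on {1..}"
    using Peq by (intro summable_on_cong) simp
  have Qsum: "(\<lambda>k. \<P>(\<omega> in M. \<exists>j\<in>incr_indices l (2 ^ k).
      relabel I (multi X l j \<omega>) \<in> B_set \<mu> d k (A k) I)) summable_on {1..} \<longleftrightarrow> Q I summable_on {1..}"
    if "I \<subseteq> {1..d}" "card I = l" for I l
    using Qeq[OF _ that] by (intro summable_on_cong) simp
  have P0: "0 \<le> P k" and Q0: "0 \<le> Q I k" and m0: "0 \<le> m k" for k I
    unfolding P_def Q_def m_def by (simp_all add: coupled_nonneg)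
  \<comment> \<open>The number of chunks must be at least \<open>d\<close> and divide \<open>2 ^ k\<close> for large \<open>k\<close>.\<close>
  define c :: nat where "c = 2 ^ d"
  have dc: "d \<le> c" unfolding c_def by (simp add: less_imp_le)
  have upper: "P k \<le> (\<Sum>I\<in>\<I>. Q I k) + m k" if "k \<ge> 1" for k
    using coupled_le_sum[OF A[OF that] \<open>d \<ge> 1\<close>, of "2 ^ k" k]
    unfolding P_def Q_def m_def \<I>_def by (simp add: power_mult)
  have hitP: "hit {1..d} (2 ^ k) (C_set \<mu> d k (A k) l) \<le> real c ^ d * P k"
    if k: "k \<ge> d" and l: "l \<le> d" for k l
  proof -
    have Ak: "A k \<in> sets (pow {1..d})" using A[of k] k \<open>d \<ge> 1\<close> by simp
    have "(2::nat) ^ k = c * 2 ^ (k - d)" unfolding c_def using k by (simp flip: power_add)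
    then have "hit {1..d} (2 ^ k) (A k) \<le> real c ^ d * P k"
      unfolding P_def using hit_le_coupled[OF Ak _ dc, of "2 ^ (k - d)"] by simp
    moreover have "hit {1..d} (2 ^ k) (C_set \<mu> d k (A k) l) \<le> hit {1..d} (2 ^ k) (A k)"
      using C_set_mono[OF l, of \<mu> d k "A k"] Ak by (intro hit_mono) (auto simp: C_set_top)
    ultimately show ?thesis by linarith
  qed
  show ?thesis
    unfolding Psum
  proof
    assume sP: "P summable_on {1..}"
    have "Q I summable_on {1..}" if I: "I \<subseteq> {1..d}" "card I \<in> {1..d - 1}" for I
    proof (rule summable_on_of_tail_le[OF sP Q0])
      fix k assume k: "d \<le> k"
      have Ak: "A k \<in> sets (pow {1..d})" using A[of k] k \<open>d \<ge> 1\<close> by simp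
      have "1 / (1 + 2 ^ d) * hit I (2 ^ k) (B_set \<mu> d k (A k) I) \<le> real c ^ d * P k"
        using hit_B_set_le[OF Ak I(1), of k] hitP[OF k, of "card I + 1"] I(2) by fastforce
      then have *: "hit I (2 ^ k) (B_set \<mu> d k (A k) I) \<le> (1 + 2 ^ d) * (real c ^ d * P k)"
        by (simp add: field_simps add_pos_pos)
      have "Q I k \<le> real (card I) ^ card I * hit I (2 ^ k) (B_set \<mu> d k (A k) I)"
        unfolding Q_def using I(2) by (intro coupled_le_hit fin[OF I(1)] B_set_sets[OF Ak I(1)]) auto
      also have "\<dots> \<le> real (card I) ^ card I * ((1 + 2 ^ d) * (real c ^ d * P k))"
        using * by (intro mult_left_mono) auto
      finally show "Q I k \<le> (real (card I) ^ card I * (1 + 2 ^ d) * real c ^ d) * P k"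
        by (simp add: mult.assoc)
    qed
    moreover have "m summable_on {1..}"
    proof (rule summable_on_of_saturated_le[OF sP m0])
      fix k assume k: "d \<le> k"
      have Ak: "A k \<in> sets (pow {1..d})" using A[of k] k \<open>d \<ge> 1\<close> by simp
      show "m k / (m k + 2 ^ d) \<le> real c ^ d * P k"
        using hit_C_set_ge[OF Ak \<open>d \<ge> 1\<close> m_def[of k]] hitP[OF k \<open>d \<ge> 1\<close>] by linarith
    qed simp
    ultimately show "(\<forall>l\<in>{1..d - 1}. \<forall>I. I \<subseteq> {1..d} \<and> card I = l \<longrightarrow>
         (\<lambda>k. \<P>(\<omega> in M. \<exists>j\<in>incr_indices l (2 ^ k).
                   relabel I (multi X l j \<omega>) \<in> B_set \<mu> d k (A k) I)) summable_on {1..}) \<and>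
      (\<lambda>k. 2 ^ (k * d) * measure (power_measure \<mu> {1..d}) (C_set \<mu> d k (A k) 1)) summable_on {1..}"
      using Qsum unfolding m_def by blast
  next
    assume "(\<forall>l\<in>{1..d - 1}. \<forall>I. I \<subseteq> {1..d} \<and> card I = l \<longrightarrow>
         (\<lambda>k. \<P>(\<omega> in M. \<exists>j\<in>incr_indices l (2 ^ k).
                   relabel I (multi X l j \<omega>) \<in> B_set \<mu> d k (A k) I)) summable_on {1..}) \<and>
      (\<lambda>k. 2 ^ (k * d) * measure (power_measure \<mu> {1..d}) (C_set \<mu> d k (A k) 1)) summable_on {1..}"
    then have "Q I summable_on {1..}" if "I \<in> \<I>" for I
      using that Qsum unfolding \<I>_def by blast
    moreover have "m summable_on {1..}"
      using \<open>_ \<and> _\<close> unfolding m_def by blast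
    ultimately have "(\<lambda>k. (\<Sum>I\<in>\<I>. Q I k) + m k) summable_on {1..}"
      using fin\<I> by (intro summable_on_add summable_on_finite_sum)
    then show "P summable_on {1..}"
      by (rule summable_on_comparison_test) (use upper P0 in auto)
  qed
qed

end
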